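(* Let $\mathcal F,\mathcal H\in C^\infty(\mathfrak M_{0,-}^{\mathrm{reg}})^{\mathbb T^n}$, and let $f,h\in C^\infty(\mathfrak M_0^{\mathrm{reg}})^{\mathbb T^n}$ be any $\mathbb T^n$-invariant smooth functions whose restrictions to $\mathfrak M_{0,-}^{\mathrm{reg}}$ are $\mathcal F,\mathcal H$. For $i=1,2$ the value $\{\mathcal F,\mathcal H\}_{i,-}^{\mathrm{red}}(x):=\{f,h\}_i^{\mathrm{red}}(x)$ at $x\in\mathfrak M_{0,-}^{\mathrm{reg}}$ does not depend on the choice of extensions, this defines two compatible Poisson brackets on $C^\infty(\mathfrak M_{0,-}^{\mathrm{reg}})^{\mathbb T^n}$, and, with derivatives evaluated at $(e^q,J^-)$, $$\{\mathcal F,\mathcal H\}_{1,-}^{\mathrm{red}}(e^q,J^-)=\langle\nabla_1\mathcal F,d_2\mathcal H\rangle-\langle\nabla_1\mathcal H,d_2\mathcal F\rangle+\langle J^-,[R(q)d_2\mathcal F,d_2\mathcal H]+[d_2\mathcal F,R(q)d_2\mathcal H]\rangle,$$ $$\{\mathcal F,\mathcal H\}_{2,-}^{\mathrm{red}}(e^q,J^-)=\langle\nabla_1\mathcal F,\nabla_2\mathcal H\rangle-\langle\nabla_1\mathcal H,\nabla_2\mathcal F\rangle+2\langle\nabla_2\mathcal F,R(q)\nabla_2\mathcal H\rangle .$$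
   Context: $\mathcal G=\mathfrak{gl}(n,\mathbb C)$ (real Lie algebra) with $\langle X,Y\rangle=\Re\operatorname{tr}(XY)$. $\mathcal G^+=\mathfrak u(n)$ (anti-Hermitian), $\mathcal G^-=\mathrm i\,\mathfrak u(n)$ (Hermitian); $X=X^++X^-$ with $X^\pm=\frac12(X\mp X^* )$; $\mathcal G^\pm_0$ are the diagonal matrices in $\mathcal G^\pm$ and $X^-_0$ denotes the diagonal part of $X^-$. $\mathfrak M_0^{\mathrm{reg}}=\{(e^q,J): J\in\mathcal G,\ q=\mathrm{diag}(q_1,\dots,q_n),\ q_i\in\mathbb R,\ q_1>\dots>q_n\}$; the torus $\mathbb T^n$ of diagonal unitary matrices acts by $(e^q,J)\mapsto(e^q,\tau J\tau^{-1})$, and $C^\infty(\cdot)^{\mathbb T^n}$ denotes invariant smooth real functions. $\mathfrak M_{0,-}^{\mathrm{reg}}=\{(e^q,J)\in\mathfrak M_0^{\mathrm{reg}}:J^+=0\}$, with points written $(e^q,J^-)$. For $f\in C^\infty(\mathfrak M_0^{\mathrm{reg}})$: $\nabla_1f\in\mathcal G^-_0$ with $\langle\nabla_1f,X_0\rangle=\frac{d}{dt}|_0f(e^{q+tX_0},J)$ ($X_0\in\mathcal G_0^-$), $d_2f\in\mathcal G$ with $\langle d_2f,X\rangle=\frac{d}{dt}|_0f(e^q,J+tX)$, $\nabla_2f=J\,d_2f$, $\nabla_2'f=(d_2f)J$. For $\mathcal F\in C^\infty(\mathfrak M_{0,-}^{\mathrm{reg}})$: $\nabla_1\mathcal F\in\mathcal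 G_0^-$ defined likewise, $d_2\mathcal F\in\mathcal G^-$ with $\langle d_2\mathcal F,X\rangle=\frac{d}{dt}|_0\mathcal F(e^q,J^-+tX)$ for $X\in\mathcal G^-$, $\nabla_2\mathcal F=J^-d_2\mathcal F$. $R(q)\in\mathrm{End}(\mathcal G)$: $(R(q)X)_{ii}=0$, $(R(q)X)_{ij}=X_{ij}\coth(q_i-q_j)$ for $i\ne j$. The compatible Poisson brackets on $C^\infty(\mathfrak M_0^{\mathrm{reg}})^{\mathbb T^n}$ are $\{f,h\}_1^{\mathrm{red}}=\langle\nabla_1f,(d_2h)^-_0\rangle-\langle\nabla_1h,(d_2f)^-_0\rangle+\langle R(q)[d_2f,J]^+,(d_2h)^-\rangle-\langle R(q)[d_2h,J]^+,(d_2f)^-\rangle+\langle J^+,[(d_2f)^-,(d_2h)^-]-[(d_2f)^+,(d_2h)^+]\rangle$; $2\{f,h\}_2^{\mathrm{red}}=\langle\nabla_1f,(\nabla_2h+\nabla_2'h)^-_0\rangle-\langle\nabla_1h,(\nabla_2f+\nabla_2'f)^-_0\rangle+\langle R(q)[d_2f,J]^+,(\nabla_2h+\nabla_2'h)^-\rangle-\langle R(q)[d_2h,J]^+,(\nabla_2f+\nabla_2'f)^-\rangle+\langle(\nabla_2f)^-,(\nabla_2'h)^-\rangle+\langle(\nabla_2'f)^+,(\nabla_2h)^+\rangle-\langle(\nabla_2'f)^-,(\nabla_2h)^-\rangle-\langle(\nabla_2f)^+,(\nabla_2'h)^+\rangle$ (derivatives at $(e^q,J)$). *)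

theory Defs
  imports "HOL-Analysis.Analysis"
begin

type_synonym 'n mat = "complex^'n^'n"
(* points (e^q, J) of M_0^reg are encoded as pairs (q, J) with q :: real^'n *)
type_synonym 'n pt = "(real^'n) \<times> 'n mat"

definition adj :: "'n::finite mat \<Rightarrow> 'n mat" where
  "adj X = (\<chi> i j. cnj (X $ j $ i))"

definition mtrace :: "'n::finite mat \<Rightarrow> complex" where
  "mtrace X = (\<Sum>i\<in>UNIV. X $ i $ i)"

definition ip :: "'n::finite mat \<Rightarrow> 'n mat \<Rightarrow> real" where
  "ip X Y = Re (mtrace (X ** Y))"

definition comm :: "'n::finite mat \<Rightarrow> 'n mat \<Rightarrow> 'n mat" where
  "comm X Y = X ** Y - Y ** X"

definition mplus :: "'n::finite mat \<Rightarrow> 'n mat" where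
  "mplus X = (1/2::real) *\<^sub>R (X - adj X)"

definition mminus :: "'n::finite mat \<Rightarrow> 'n mat" where
  "mminus X = (1/2::real) *\<^sub>R (X + adj X)"

definition diagpart :: "'n::finite mat \<Rightarrow> 'n mat" where
  "diagpart X = (\<chi> i j. if i = j then X $ i $ j else 0)"

definition herm :: "'n::finite mat \<Rightarrow> bool" where
  "herm X \<longleftrightarrow> adj X = X"

definition G0minus :: "'n::finite mat set" where
  "G0minus = {X. herm X \<and> diagpart X = X}"

definition diagvec :: "'n::finite mat \<Rightarrow> real^'n" where
  "diagvec X = (\<chi> i. Re (X $ i $ i))"

definition Rq :: "real^'n \<Rightarrow> 'n::finite mat \<Rightarrow> 'n mat" where
  "Rq q X = (\<chi> i j. if i = j then 0
      else X $ i $ j * complex_of_real (cosh (q $ i - q $ j) / sinh (q $ i - q $ j)))"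

definition M0reg :: "('n::{finite,linorder}) pt set" where
  "M0reg = {(q, J). \<forall>i j. i < j \<longrightarrow> q $ i > q $ j}"

definition M0minus :: "('n::{finite,linorder}) pt set" where
  "M0minus = {(q, J). (q, J) \<in> M0reg \<and> mplus J = 0}"

(* tangent directions of M_{0,-}^reg *)
definition Vminus :: "('n::finite) pt set" where
  "Vminus = {(x, X). herm X}"

definition torus :: "'n::finite mat set" where
  "torus = {\<tau>. diagpart \<tau> = \<tau> \<and> \<tau> ** adj \<tau> = mat 1}"

definition tact :: "'n::finite mat \<Rightarrow> 'n pt \<Rightarrow> 'n pt" where
  "tact \<tau> p = (fst p, \<tau> ** snd p ** matrix_inv \<tau>)"

definition dirderiv :: "('a::real_normed_vector \<Rightarrow> real) \<Rightarrow> 'a \<Rightarrow> 'a \<Rightarrow> real" where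
  "dirderiv f x v = Lim (at (0::real)) (\<lambda>t. (f (x + t *\<^sub>R v) - f x) / t)"

fun iter_dd :: "('a::real_normed_vector \<Rightarrow> real) \<Rightarrow> 'a list \<Rightarrow> 'a \<Rightarrow> real" where
  "iter_dd f [] = f"
| "iter_dd f (v # vs) = (\<lambda>x. dirderiv (iter_dd f vs) x v)"

(* f is C-infinity on S, S relatively open in the linear subspace V:
   all iterated directional derivatives along V exist and are continuous on S *)
definition smooth_along :: "'a set \<Rightarrow> 'a set \<Rightarrow> ('a::real_normed_vector \<Rightarrow> real) \<Rightarrow> bool" where
  "smooth_along V S f \<longleftrightarrow>
     (\<forall>vs. set vs \<subseteq> V \<longrightarrow>
        (\<forall>x\<in>S. continuous (at x within S) (iter_dd f vs) \<and>
           (\<forall>v\<in>V. ((\<lambda>t. (iter_dd f vs (x + t *\<^sub>R v) - iter_dd f vs x) / t)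
                     \<longlongrightarrow> dirderiv (iter_dd f vs) x v) (at 0))))"

definition invariant_on :: "('n::finite) pt set \<Rightarrow> ('n pt \<Rightarrow> real) \<Rightarrow> bool" where
  "invariant_on S f \<longleftrightarrow> (\<forall>\<tau>\<in>torus. \<forall>p\<in>S. f (tact \<tau> p) = f p)"

definition Cinv0 :: "(('n::{finite,linorder}) pt \<Rightarrow> real) set" where
  "Cinv0 = {f. smooth_along UNIV M0reg f \<and> invariant_on M0reg f}"

definition Cinvm :: "(('n::{finite,linorder}) pt \<Rightarrow> real) set" where
  "Cinvm = {F. smooth_along Vminus M0minus F \<and> invariant_on M0minus F}"

(* nabla_1 f in G_0^- : <nabla_1 f, X0> = d/dt f(e^{q+t X0}, J) *)
definition nabla1 :: "('n::finite pt \<Rightarrow> real) \<Rightarrow> 'n pt \<Rightarrow> 'n mat" where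
  "nabla1 f p = (THE D. D \<in> G0minus \<and>
      (\<forall>X0\<in>G0minus. ip D X0 = dirderiv f p (diagvec X0, 0)))"

definition d2 :: "('n::finite pt \<Rightarrow> real) \<Rightarrow> 'n pt \<Rightarrow> 'n mat" where
  "d2 f p = (THE D. \<forall>X. ip D X = dirderiv f p (0, X))"

definition d2m :: "('n::finite pt \<Rightarrow> real) \<Rightarrow> 'n pt \<Rightarrow> 'n mat" where
  "d2m F p = (THE D. herm D \<and> (\<forall>X. herm X \<longrightarrow> ip D X = dirderiv F p (0, X)))"

definition nabla2 :: "('n::finite pt \<Rightarrow> real) \<Rightarrow> 'n pt \<Rightarrow> 'n mat" where
  "nabla2 f p = snd p ** d2 f p"

definition nabla2' :: "('n::finite pt \<Rightarrow> real) \<Rightarrow> 'n pt \<Rightarrow> 'n mat" where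
  "nabla2' f p = d2 f p ** snd p"

definition nabla2m :: "('n::finite pt \<Rightarrow> real) \<Rightarrow> 'n pt \<Rightarrow> 'n mat" where
  "nabla2m F p = snd p ** d2m F p"

definition red1 :: "('n::finite pt \<Rightarrow> real) \<Rightarrow> ('n pt \<Rightarrow> real) \<Rightarrow> 'n pt \<Rightarrow> real" where
  "red1 f h p = (let q = fst p; J = snd p; df = d2 f p; dh = d2 h p in
      ip (nabla1 f p) (diagpart (mminus dh)) - ip (nabla1 h p) (diagpart (mminus df))
    + ip (Rq q (mplus (comm df J))) (mminus dh) - ip (Rq q (mplus (comm dh J))) (mminus df)
    + ip (mplus J) (comm (mminus df) (mminus dh) - comm (mplus df) (mplus dh)))"

definition red2 :: "('n::finite pt \<Rightarrow> real) \<Rightarrow> ('n pt \<Rightarrow> real) \<Rightarrow> 'n pt \<Rightarrow> real" where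
  "red2 f h p = (let q = fst p; J = snd p; df = d2 f p; dh = d2 h p;
        Nf = nabla2 f p; Nf' = nabla2' f p; Nh = nabla2 h p; Nh' = nabla2' h p in
     (1/2) * (
      ip (nabla1 f p) (diagpart (mminus (Nh + Nh'))) - ip (nabla1 h p) (diagpart (mminus (Nf + Nf')))
    + ip (Rq q (mplus (comm df J))) (mminus (Nh + Nh'))
    - ip (Rq q (mplus (comm dh J))) (mminus (Nf + Nf'))
    + ip (mminus Nf) (mminus Nh') + ip (mplus Nf') (mplus Nh)
    - ip (mminus Nf') (mminus Nh) - ip (mplus Nf) (mplus Nh')))"

definition is_ext :: "('n::{finite,linorder} pt \<Rightarrow> real) \<Rightarrow> ('n pt \<Rightarrow> real) \<Rightarrow> bool" where
  "is_ext f F \<longleftrightarrow> f \<in> Cinv0 \<and> (\<forall>p\<in>M0minus. f p = F p)"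

definition red1m :: "('n::{finite,linorder} pt \<Rightarrow> real) \<Rightarrow> ('n pt \<Rightarrow> real) \<Rightarrow> 'n pt \<Rightarrow> real" where
  "red1m F H p = red1 (SOME f. is_ext f F) (SOME h. is_ext h H) p"

definition red2m :: "('n::{finite,linorder} pt \<Rightarrow> real) \<Rightarrow> ('n pt \<Rightarrow> real) \<Rightarrow> 'n pt \<Rightarrow> real" where
  "red2m F H p = red2 (SOME f. is_ext f F) (SOME h. is_ext h H) p"

definition poisson_on :: "('x \<Rightarrow> real) set \<Rightarrow> 'x set \<Rightarrow>
    (('x \<Rightarrow> real) \<Rightarrow> ('x \<Rightarrow> real) \<Rightarrow> 'x \<Rightarrow> real) \<Rightarrow> bool" where
  "poisson_on A S B \<longleftrightarrow>
     (\<forall>F\<in>A. \<forall>H\<in>A. B F H \<in> A) \<and>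
     (\<forall>F\<in>A. \<forall>G\<in>A. \<forall>H\<in>A. \<forall>a b::real. \<forall>x\<in>S.
         B (\<lambda>y. a * F y + b * G y) H x = a * B F H x + b * B G H x) \<and>
     (\<forall>F\<in>A. \<forall>H\<in>A. \<forall>x\<in>S. B F H x = - B H F x) \<and>
     (\<forall>F\<in>A. \<forall>G\<in>A. \<forall>H\<in>A. \<forall>x\<in>S.
         B F (\<lambda>y. G y * H y) x = B F G x * H x + G x * B F H x) \<and>
     (\<forall>F\<in>A. \<forall>G\<in>A. \<forall>H\<in>A. \<forall>x\<in>S.
         B F (B G H) x + B G (B H F) x + B H (B F G) x = 0)"

definition compatible_poisson :: "('x \<Rightarrow> real) set \<Rightarrow> 'x set \<Rightarrow>
    (('x \<Rightarrow> real) \<Rightarrow> ('x \<Rightarrow> real) \<Rightarrow> 'x \<Rightarrow> real) \<Rightarrow>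
    (('x \<Rightarrow> real) \<Rightarrow> ('x \<Rightarrow> real) \<Rightarrow> 'x \<Rightarrow> real) \<Rightarrow> bool" where
  "compatible_poisson A S B1 B2 \<longleftrightarrow>
     (\<forall>a b::real. poisson_on A S (\<lambda>F H x. a * B1 F H x + b * B2 F H x))"

end

(* A function on the Hermitian part is extended by composing with the Hermitian projection of J, and
   trace identities express both brackets at Hermitian J through the gradients along Hermitian
   directions. Hence {F,H}_i(x) = Pi_i(x)(dF,dH) for explicit bivectors Pi_1, Pi_2. In the Jacobi
   identity the second derivatives cancel by symmetry, which leaves the Schouten bracket of the
   bivector, evaluated on differentials of torus-invariant functions. For Pi_2 it vanishes by the
   dynamical Yang-Baxter equation for R(q); invariance enters as reality of the diagonal of J dF.
   Since Pi_2 at J + e 1 equals Pi_2 + e Pi_1, comparing powers of e gives the Schouten identity for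
   the whole pencil spanned by Pi_1 and Pi_2. *)
theory Submission
  imports Defs
begin

subsection \<open>Functions smooth along a linear subspace\<close>

text \<open>Smoothness is given only through iterated directional derivatives tangent to the
  Hermitian slice, and a function is uncontrolled off the slice. Linearity of the differential,
  symmetry of Hessians and the chain rule along curves are therefore extracted from the mean value
  theorem, and gradients are projected onto the tangent space. The Jacobi identity is proved on the
  slice itself, not inherited from the unreduced brackets. Reality of the diagonal of J dF comes
  from the k-th circle of the torus, which moves J with velocity [i E_kk, J]. It matters because
  index coincidences in the coth identity leave products with a diagonal entry of J dF, whereas the
  derivative of R(q) along a Hamiltonian direction sees only the real part of that entry. Passing to
  J + e 1 preserves this reality, since a Hermitian matrix has a real diagonal, and it yields no e^2
  term, because R(q) sends Hermitian matrices to anti-Hermitian ones, which are orthogonal to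
  Hermitian ones for the trace form.\<close>

lemma has_real_derivative_line_iff:
  fixes f :: "'a::real_normed_vector \<Rightarrow> real"
  shows "((\<lambda>t. f (x + t *\<^sub>R v)) has_real_derivative D) (at 0) \<longleftrightarrow>
   ((\<lambda>t. (f (x + t *\<^sub>R v) - f x) / t) \<longlongrightarrow> D) (at 0)"
  by (simp add: DERIV_def)

lemma dirderiv_eqI:
  assumes "((\<lambda>t. f (x + t *\<^sub>R v)) has_real_derivative D) (at 0)"
  shows "dirderiv f x v = D"
  using assms unfolding has_real_derivative_line_iff dirderiv_def
  by (intro tendsto_Lim) auto

lemma iter_dd_append: "iter_dd f (us @ vs) = iter_dd (iter_dd f vs) us"
  by (induction us) auto

text \<open>One calculus for two situations: the regular phase space with all directions, and its
  Hermitian slice with directions whose matrix part is Hermitian.\<close>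

locale relatively_open =
  fixes V S :: "'a::euclidean_space set"
  assumes subspace_V: "subspace V"
    and rel_open: "x \<in> S \<Longrightarrow> \<exists>e>0. \<forall>v\<in>V. norm v < e \<longrightarrow> x + v \<in> S"
begin

lemma V_scale: "v \<in> V \<Longrightarrow> c *\<^sub>R v \<in> V"
  and V_add: "v \<in> V \<Longrightarrow> w \<in> V \<Longrightarrow> v + w \<in> V"
  using subspace_V by (auto simp: subspace_def)

lemma eventually_line:
  assumes "x \<in> S" "v \<in> V"
  shows "\<forall>\<^sub>F t in nhds 0. x + t *\<^sub>R v \<in> S"
proof -
  obtain e where e: "e > 0" "\<forall>v\<in>V. norm v < e \<longrightarrow> x + v \<in> S"
    using rel_open assms by blast
  have "((\<lambda>t. norm (t *\<^sub>R v)) \<longlongrightarrow> norm ((0::real) *\<^sub>R v)) (nhds 0)"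
    by (intro tendsto_intros filterlim_ident)
  then have "\<forall>\<^sub>F t in nhds 0. norm (t *\<^sub>R v) < e"
    using e(1) by (auto intro: order_tendstoD)
  then show ?thesis
    by eventually_elim (simp add: e(2) assms V_scale)
qed

lemma line_derivative_cong:
  assumes "x \<in> S" "v \<in> V" "\<And>y. y \<in> S \<Longrightarrow> f y = g y"
  shows "((\<lambda>t. f (x + t *\<^sub>R v)) has_real_derivative D) (at 0) \<longleftrightarrow>
         ((\<lambda>t. g (x + t *\<^sub>R v)) has_real_derivative D) (at 0)"
proof (rule DERIV_cong_ev)
  show "\<forall>\<^sub>F t in nhds 0. f (x + t *\<^sub>R v) = g (x + t *\<^sub>R v)"
    using eventually_line[OF assms(1,2)] by eventually_elim (rule assms(3))
qed auto

text \<open>No differentiability is assumed: \<open>Lim\<close> is a description operator, so it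
  suffices that both difference quotients have the same limits, even if there are none.\<close>

lemma dirderiv_cong:
  assumes "x \<in> S" "v \<in> V" "\<And>y. y \<in> S \<Longrightarrow> f y = g y"
  shows "dirderiv f x v = dirderiv g x v"
  using line_derivative_cong[OF assms(1,2), of f g] assms(3)
  unfolding dirderiv_def has_real_derivative_line_iff t2_space_class.Lim_def by presburger

lemma iter_dd_cong:
  assumes "\<And>y. y \<in> S \<Longrightarrow> f y = g y" "set vs \<subseteq> V" "x \<in> S"
  shows "iter_dd f vs x = iter_dd g vs x"
  using assms(2,3)
proof (induction vs arbitrary: x)
  case (Cons v vs)
  then show ?case by (auto intro: dirderiv_cong)
qed (use assms(1) in simp)

abbreviation "smooth \<equiv> smooth_along V S"

text \<open>Lets a bracket inherit smoothness from an explicit expression that equals it only on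
  \<open>S\<close>.\<close>

lemma smooth_cong:
  assumes "\<And>y. y \<in> S \<Longrightarrow> f y = g y" "smooth f"
  shows "smooth g"
proof -
  have *: "iter_dd f vs y = iter_dd g vs y" if "set vs \<subseteq> V" "y \<in> S" for vs y
    using that assms(1) by (intro iter_dd_cong)
  have "continuous (at x within S) (iter_dd g vs) \<and>
      ((\<lambda>t. iter_dd g vs (x + t *\<^sub>R v)) has_real_derivative dirderiv (iter_dd g vs) x v) (at 0)"
    if "set vs \<subseteq> V" "x \<in> S" "v \<in> V" for vs x v
  proof
    have "continuous (at x within S) (iter_dd f vs)"
      using assms(2) that unfolding smooth_along_def by blast
    then show "continuous (at x within S) (iter_dd g vs)"
      using * that by (auto simp: continuous_within intro: Lim_transform_within[of _ _ _ _ 1])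
    have "((\<lambda>t. iter_dd f vs (x + t *\<^sub>R v)) has_real_derivative dirderiv (iter_dd f vs) x v) (at 0)"
      using assms(2) that unfolding smooth_along_def has_real_derivative_line_iff by blast
    then show "((\<lambda>t. iter_dd g vs (x + t *\<^sub>R v)) has_real_derivative dirderiv (iter_dd g vs) x v) (at 0)"
      using line_derivative_cong[OF that(2,3), of "iter_dd f vs" "iter_dd g vs"]
        dirderiv_cong[OF that(2,3), of "iter_dd f vs" "iter_dd g vs"] *[OF that(1)] by simp
  qed
  note main = this[unfolded has_real_derivative_line_iff]
  show ?thesis
    unfolding smooth_along_def
  proof (intro allI impI ballI conjI)
    fix vs x assume vs: "set vs \<subseteq> V" and x: "x \<in> S"
    show "continuous (at x within S) (iter_dd g vs)"
      using main[OF vs x subspace_0[OF subspace_V]] by (rule conjunct1)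
    fix v assume "v \<in> V"
    with main[OF vs x] show "((\<lambda>t. (iter_dd g vs (x + t *\<^sub>R v) - iter_dd g vs x) / t)
        \<longlongrightarrow> dirderiv (iter_dd g vs) x v) (at 0)"
      by (rule_tac conjunct2)
  qed
qed

lemma smooth_derivative:
  assumes "smooth f" "x \<in> S" "v \<in> V"
  shows "((\<lambda>t. f (x + t *\<^sub>R v)) has_real_derivative dirderiv f x v) (at 0)"
  using assms(1)[unfolded smooth_along_def, rule_format, of "[]", OF _ assms(2)] assms(3)
  by (simp add: has_real_derivative_line_iff)

lemma smooth_continuous:
  assumes "smooth f" "x \<in> S"
  shows "continuous (at x within S) f"
  using assms(1)[unfolded smooth_along_def, rule_format, of "[]", OF _ assms(2)] by simp

lemma smooth_derivative_at:
  assumes "smooth f" "x + s *\<^sub>R v \<in> S" "v \<in> V"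
  shows "((\<lambda>t. f (x + t *\<^sub>R v)) has_real_derivative dirderiv f (x + s *\<^sub>R v) v) (at s)"
proof -
  have "((\<lambda>t. f (x + (s + t) *\<^sub>R v)) has_real_derivative dirderiv f (x + s *\<^sub>R v) v) (at 0)"
    using smooth_derivative[OF assms] by (simp add: algebra_simps)
  then show ?thesis
    using DERIV_shift[of "\<lambda>t. f (x + t *\<^sub>R v)" _ 0 s] by (simp add: add.commute)
qed

lemma smooth_dirderiv:
  assumes "smooth f" "v \<in> V"
  shows "smooth (\<lambda>x. dirderiv f x v)"
proof -
  have eq: "iter_dd (\<lambda>x. dirderiv f x v) vs = iter_dd f (vs @ [v])" for vs
    by (simp add: iter_dd_append)
  have "set (vs @ [v]) \<subseteq> V" if "set vs \<subseteq> V" for vs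
    using that assms by auto
  then show ?thesis
    using assms(1) unfolding smooth_along_def eq by blast
qed

lemma dirderiv_scale:
  assumes "smooth f" "x \<in> S" "v \<in> V"
  shows "dirderiv f x (c *\<^sub>R v) = c * dirderiv f x v"
proof (rule dirderiv_eqI)
  have "((\<lambda>s. f (x + s *\<^sub>R v)) has_real_derivative dirderiv f x v) (at (c * 0))"
    using smooth_derivative[OF assms] by simp
  then have "((\<lambda>t. f (x + (c * t) *\<^sub>R v)) has_real_derivative dirderiv f x v * c) (at 0)"
    by (rule DERIV_chain2) (auto intro!: derivative_eq_intros)
  then show "((\<lambda>t. f (x + t *\<^sub>R c *\<^sub>R v)) has_real_derivative c * dirderiv f x v) (at 0)"
    by (simp add: mult.commute)
qed

section \<open>Mean value arguments: linearity in the direction and symmetry of second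
  derivatives\<close>

lemma mvt_line:
  assumes "smooth f" "v \<in> V" and seg: "\<And>s. \<bar>s\<bar> \<le> \<bar>t\<bar> \<Longrightarrow> x + s *\<^sub>R v \<in> S"
  shows "\<exists>s. \<bar>s\<bar> \<le> \<bar>t\<bar> \<and> f (x + t *\<^sub>R v) - f x = t * dirderiv f (x + s *\<^sub>R v) v"
proof -
  have d: "((\<lambda>t. f (x + t *\<^sub>R v)) has_real_derivative dirderiv f (x + s *\<^sub>R v) v) (at s)"
    if "\<bar>s\<bar> \<le> \<bar>t\<bar>" for s
    using smooth_derivative_at assms that by blast
  consider "t = 0" | "0 < t" | "t < 0" by linarith
  then show ?thesis
  proof cases
    case 1 then show ?thesis by (intro exI[of _ 0]) simp
  next
    case 2
    then obtain z where "0 < z" "z < t"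
      "f (x + t *\<^sub>R v) - f (x + 0 *\<^sub>R v) = (t - 0) * dirderiv f (x + z *\<^sub>R v) v"
      using MVT2[of 0 t "\<lambda>t. f (x + t *\<^sub>R v)" "\<lambda>s. dirderiv f (x + s *\<^sub>R v) v"] d by force
    then show ?thesis by (intro exI[of _ z]) auto
  next
    case 3
    then obtain z where "t < z" "z < 0"
      "f (x + 0 *\<^sub>R v) - f (x + t *\<^sub>R v) = (0 - t) * dirderiv f (x + z *\<^sub>R v) v"
      using MVT2[of t 0 "\<lambda>t. f (x + t *\<^sub>R v)" "\<lambda>s. dirderiv f (x + s *\<^sub>R v) v"] d by force
    then show ?thesis by (intro exI[of _ z]) (auto simp: algebra_simps)
  qed
qed

lemma small_parallelogram:
  assumes "x \<in> S" "v \<in> V" "w \<in> V"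
  obtains e where "e > 0" "\<And>s r. \<bar>s\<bar> < e \<Longrightarrow> \<bar>r\<bar> < e \<Longrightarrow> x + s *\<^sub>R v + r *\<^sub>R w \<in> S"
proof -
  obtain e where e: "e > 0" "\<forall>v\<in>V. norm v < e \<longrightarrow> x + v \<in> S"
    using rel_open assms by blast
  \<comment> \<open>The summand 1 keeps the denominator positive when both directions vanish, and it
    makes the estimate below strict.\<close>
  define d where "d = e / (norm v + norm w + 1)"
  have pos: "norm v + norm w + 1 > 0" by (smt (verit) norm_ge_zero)
  have "x + s *\<^sub>R v + r *\<^sub>R w \<in> S" if "\<bar>s\<bar> < d" "\<bar>r\<bar> < d" for s r
  proof -
    have "norm (s *\<^sub>R v + r *\<^sub>R w) \<le> \<bar>s\<bar> * norm v + \<bar>r\<bar> * norm w"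
      using norm_triangle_ineq[of "s *\<^sub>R v" "r *\<^sub>R w"] by simp
    also have "\<dots> \<le> d * norm v + d * norm w"
      using that by (intro add_mono mult_right_mono) auto
    also have "\<dots> < d * (norm v + norm w + 1)"
      using that by (simp add: algebra_simps)
    also have "\<dots> = e" using pos by (simp add: d_def)
    finally show ?thesis
      using e V_add V_scale assms by (metis add.assoc)
  qed
  moreover have "d > 0" using e pos by (simp add: d_def)
  ultimately show thesis using that by blast
qed

text \<open>Handles the unspecified intermediate points produced by the mean value theorem: they are
  squeezed to x, so a continuous derivative evaluated there tends to its value at x.\<close>

lemma continuous_limit_parallelogram:
  assumes "smooth g" "x \<in> S" "v \<in> V" "w \<in> V"
    and "\<forall>\<^sub>F t in at 0. \<bar>a t\<bar> \<le> \<bar>t\<bar> \<and> \<bar>b t\<bar> \<le> \<bar>t\<bar>"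
  shows "((\<lambda>t. g (x + a t *\<^sub>R v + b t *\<^sub>R w)) \<longlongrightarrow> g x) (at (0::real))"
proof -
  obtain e where e: "e > 0" "\<And>s r. \<bar>s\<bar> < e \<Longrightarrow> \<bar>r\<bar> < e \<Longrightarrow> x + s *\<^sub>R v + r *\<^sub>R w \<in> S"
    using small_parallelogram assms(2-4) by blast
  have lim: "((\<lambda>t. c t) \<longlongrightarrow> 0) (at (0::real))" if "\<forall>\<^sub>F t in at 0. \<bar>c t\<bar> \<le> \<bar>t\<bar>" for c :: "real \<Rightarrow> real"
  proof (rule Lim_null_comparison[where g = "\<lambda>t. \<bar>t\<bar>"])
    show "\<forall>\<^sub>F t in at 0. norm (c t) \<le> \<bar>t\<bar>" using that by simp
    show "((\<lambda>t. \<bar>t\<bar>) \<longlongrightarrow> (0::real)) (at 0)" by (intro tendsto_rabs_zero tendsto_ident_at)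
  qed
  have ab: "(a \<longlongrightarrow> 0) (at 0)" "(b \<longlongrightarrow> 0) (at 0)"
    using assms(5) by (auto intro!: lim elim: eventually_mono)
  have "((\<lambda>t. x + a t *\<^sub>R v + b t *\<^sub>R w) \<longlongrightarrow> x + 0 *\<^sub>R v + 0 *\<^sub>R w) (at 0)"
    by (intro tendsto_intros ab)
  then have 1: "((\<lambda>t. x + a t *\<^sub>R v + b t *\<^sub>R w) \<longlongrightarrow> x) (at 0)" by simp
  have ev: "\<forall>\<^sub>F t in at (0::real). \<bar>t\<bar> < e"
    using e(1) by (auto simp: eventually_at intro!: exI[of _ e])
  have 2: "\<forall>\<^sub>F t in at 0. x + a t *\<^sub>R v + b t *\<^sub>R w \<in> S"
    using assms(5) ev by eventually_elim (auto intro!: e(2))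
  show ?thesis
    by (rule continuous_within_tendsto_compose[OF smooth_continuous[OF assms(1,2)] 2 1])
qed

text \<open>The step along v + w is split into a leg along v and a leg along w. The second leg
  starts at a moving point, so its quotient is a derivative at an intermediate point, and continuity
  of that derivative is what is used.\<close>

lemma dirderiv_add:
  assumes "smooth f" "x \<in> S" "v \<in> V" "w \<in> V"
  shows "dirderiv f x (v + w) = dirderiv f x v + dirderiv f x w"
proof (rule dirderiv_eqI)
  obtain e where e: "e > 0" "\<And>s r. \<bar>s\<bar> < e \<Longrightarrow> \<bar>r\<bar> < e \<Longrightarrow> x + s *\<^sub>R v + r *\<^sub>R w \<in> S"
    using small_parallelogram assms(2-4) by blast
  have "\<exists>s. \<bar>s\<bar> \<le> \<bar>t\<bar> \<and> f (x + t *\<^sub>R v + t *\<^sub>R w) - f (x + t *\<^sub>R v)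
          = t * dirderiv f (x + t *\<^sub>R v + s *\<^sub>R w) w" if "\<bar>t\<bar> < e" for t
    using that by (intro mvt_line assms e(2)) auto
  then obtain s where s: "\<And>t. \<bar>t\<bar> < e \<Longrightarrow> \<bar>s t\<bar> \<le> \<bar>t\<bar> \<and> f (x + t *\<^sub>R v + t *\<^sub>R w) - f (x + t *\<^sub>R v)
          = t * dirderiv f (x + t *\<^sub>R v + s t *\<^sub>R w) w" by metis
  have ev: "\<forall>\<^sub>F t in at (0::real). \<bar>t\<bar> < e \<and> t \<noteq> 0"
    using e(1) by (auto simp: eventually_at intro!: exI[of _ e])
  have "((\<lambda>t. dirderiv f (x + t *\<^sub>R v + s t *\<^sub>R w) w) \<longlongrightarrow> dirderiv f x w) (at 0)"
  proof (intro continuous_limit_parallelogram smooth_dirderiv assms)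
    show "\<forall>\<^sub>F t in at 0. \<bar>t\<bar> \<le> \<bar>t\<bar> \<and> \<bar>s t\<bar> \<le> \<bar>t\<bar>"
      using ev by eventually_elim (use s in blast)
  qed
  moreover have "((\<lambda>t. (f (x + t *\<^sub>R v) - f x) / t) \<longlongrightarrow> dirderiv f x v) (at 0)"
    using smooth_derivative[OF assms(1-3)] by (simp add: has_real_derivative_line_iff)
  ultimately have "((\<lambda>t. (f (x + t *\<^sub>R v) - f x) / t + dirderiv f (x + t *\<^sub>R v + s t *\<^sub>R w) w)
      \<longlongrightarrow> dirderiv f x v + dirderiv f x w) (at 0)"
    by (intro tendsto_add)
  moreover have "\<forall>\<^sub>F t in at 0. (f (x + t *\<^sub>R v) - f x) / t + dirderiv f (x + t *\<^sub>R v + s t *\<^sub>R w) w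
      = (f (x + t *\<^sub>R (v + w)) - f x) / t"
    using ev
  proof eventually_elim
    case (elim t)
    then have "dirderiv f (x + t *\<^sub>R v + s t *\<^sub>R w) w = (f (x + t *\<^sub>R v + t *\<^sub>R w) - f (x + t *\<^sub>R v)) / t"
      using s[of t] by simp
    then show ?case by (simp add: algebra_simps diff_divide_distrib)
  qed
  ultimately show "((\<lambda>t. f (x + t *\<^sub>R (v + w))) has_real_derivative dirderiv f x v + dirderiv f x w) (at 0)"
    unfolding has_real_derivative_line_iff by (rule Lim_transform_eventually)
qed

lemma dirderiv_sum:
  assumes "smooth f" "x \<in> S" "finite I" "\<And>i. i \<in> I \<Longrightarrow> u i \<in> V"
  shows "dirderiv f x (\<Sum>i\<in>I. c i *\<^sub>R u i) = (\<Sum>i\<in>I. c i * dirderiv f x (u i))"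
  using assms(3,4)
proof (induction I rule: finite_induct)
  case empty
  show ?case using dirderiv_scale[OF assms(1,2), of 0 0] subspace_0[OF subspace_V] by simp
next
  case (insert i I)
  have "(\<Sum>i\<in>I. c i *\<^sub>R u i) \<in> V"
    using insert by (intro subspace_sum subspace_V V_scale) auto
  then show ?case using insert by (simp add: dirderiv_add[OF assms(1,2)] dirderiv_scale[OF assms(1,2)] V_scale)
qed

text \<open>The double difference is symmetric in v and w while the limit is an iterated derivative
  in a definite order; this is the classical route to equality of mixed derivatives.\<close>

lemma double_difference_tendsto:
  assumes "smooth f" "x \<in> S" "v \<in> V" "w \<in> V"
  shows "((\<lambda>t. (f (x + t *\<^sub>R v + t *\<^sub>R w) - f (x + t *\<^sub>R v) - f (x + t *\<^sub>R w) + f x) / (t * t))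
      \<longlongrightarrow> dirderiv (\<lambda>y. dirderiv f y v) x w) (at 0)"
proof -
  obtain e where e: "e > 0" "\<And>s r. \<bar>s\<bar> < e \<Longrightarrow> \<bar>r\<bar> < e \<Longrightarrow> x + s *\<^sub>R v + r *\<^sub>R w \<in> S"
    using small_parallelogram assms(2-4) by blast
  let ?\<Delta> = "\<lambda>t. f (x + t *\<^sub>R v + t *\<^sub>R w) - f (x + t *\<^sub>R v) - f (x + t *\<^sub>R w) + f x"
  have "\<exists>s r. \<bar>s\<bar> \<le> \<bar>t\<bar> \<and> \<bar>r\<bar> \<le> \<bar>t\<bar> \<and>
     ?\<Delta> t = t * (t * dirderiv (\<lambda>y. dirderiv f y v) (x + s *\<^sub>R v + r *\<^sub>R w) w)" if t: "\<bar>t\<bar> < e" for t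
  proof -
    \<comment> \<open>The difference in direction w is kept inside \<open>\<phi>\<close>, so one
      mean value step in r produces a difference of first derivatives along v, to which a second
      step in direction w applies.\<close>
    define \<phi> where "\<phi> r = f ((x + t *\<^sub>R w) + r *\<^sub>R v) - f (x + r *\<^sub>R v)" for r
    define \<phi>' where "\<phi>' r = dirderiv f ((x + t *\<^sub>R w) + r *\<^sub>R v) v - dirderiv f (x + r *\<^sub>R v) v" for r
    have d: "(\<phi> has_real_derivative \<phi>' r) (at r)" if "\<bar>r\<bar> \<le> \<bar>t\<bar>" for r
    proof -
      have "x + r *\<^sub>R v + t *\<^sub>R w \<in> S" "x + r *\<^sub>R v + 0 *\<^sub>R w \<in> S"
        using that t e(1) by (auto intro: e(2) simp del: scaleR_zero_left)
      then show ?thesis unfolding \<phi>_def \<phi>'_def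
        by (intro DERIV_diff smooth_derivative_at assms) (auto simp: ac_simps)
    qed
    have "\<exists>s. \<bar>s\<bar> \<le> \<bar>t\<bar> \<and> \<phi> t - \<phi> 0 = t * \<phi>' s"
    proof -
      consider "t = 0" | "0 < t" | "t < 0" by linarith
      then show ?thesis
      proof cases
        case 1 then show ?thesis by (intro exI[of _ 0]) simp
      next
        case 2
        then obtain z where "0 < z" "z < t" "\<phi> t - \<phi> 0 = (t - 0) * \<phi>' z"
          using MVT2[of 0 t \<phi> \<phi>'] d by force
        then show ?thesis by (intro exI[of _ z]) auto
      next
        case 3
        then obtain z where "t < z" "z < 0" "\<phi> 0 - \<phi> t = (0 - t) * \<phi>' z"
          using MVT2[of t 0 \<phi> \<phi>'] d by force
        then show ?thesis by (intro exI[of _ z]) (auto simp: algebra_simps)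
      qed
    qed
    then obtain s where s: "\<bar>s\<bar> \<le> \<bar>t\<bar>" "\<phi> t - \<phi> 0 = t * \<phi>' s" by blast
    have "\<exists>r. \<bar>r\<bar> \<le> \<bar>t\<bar> \<and> dirderiv f (x + s *\<^sub>R v + t *\<^sub>R w) v - dirderiv f (x + s *\<^sub>R v) v
        = t * dirderiv (\<lambda>y. dirderiv f y v) (x + s *\<^sub>R v + r *\<^sub>R w) w"
      using t s by (intro mvt_line smooth_dirderiv assms e(2)) auto
    then obtain r where r: "\<bar>r\<bar> \<le> \<bar>t\<bar>" "dirderiv f (x + s *\<^sub>R v + t *\<^sub>R w) v - dirderiv f (x + s *\<^sub>R v) v
        = t * dirderiv (\<lambda>y. dirderiv f y v) (x + s *\<^sub>R v + r *\<^sub>R w) w" by blast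
    have swap: "x + t *\<^sub>R w + c *\<^sub>R v = x + c *\<^sub>R v + t *\<^sub>R w" for c
      by (simp add: ac_simps)
    have "?\<Delta> t = \<phi> t - \<phi> 0" by (simp add: \<phi>_def swap)
    also have "\<dots> = t * (t * dirderiv (\<lambda>y. dirderiv f y v) (x + s *\<^sub>R v + r *\<^sub>R w) w)"
      using s(2) r(2) by (simp add: \<phi>'_def swap)
    finally show ?thesis using s(1) r(1) by blast
  qed
  then have "\<forall>t. \<exists>s r. \<bar>t\<bar> < e \<longrightarrow> \<bar>s\<bar> \<le> \<bar>t\<bar> \<and> \<bar>r\<bar> \<le> \<bar>t\<bar> \<and>
     ?\<Delta> t = t * (t * dirderiv (\<lambda>y. dirderiv f y v) (x + s *\<^sub>R v + r *\<^sub>R w) w)" by blast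
  then obtain s r where sr: "\<And>t. \<bar>t\<bar> < e \<Longrightarrow> \<bar>s t\<bar> \<le> \<bar>t\<bar> \<and> \<bar>r t\<bar> \<le> \<bar>t\<bar> \<and>
     ?\<Delta> t = t * (t * dirderiv (\<lambda>y. dirderiv f y v) (x + s t *\<^sub>R v + r t *\<^sub>R w) w)"
    unfolding choice_iff by blast
  have ev: "\<forall>\<^sub>F t in at (0::real). \<bar>t\<bar> < e \<and> t \<noteq> 0"
    using e(1) by (auto simp: eventually_at intro!: exI[of _ e])
  have "((\<lambda>t. dirderiv (\<lambda>y. dirderiv f y v) (x + s t *\<^sub>R v + r t *\<^sub>R w) w)
      \<longlongrightarrow> dirderiv (\<lambda>y. dirderiv f y v) x w) (at 0)"
  proof (intro continuous_limit_parallelogram smooth_dirderiv assms)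
    show "\<forall>\<^sub>F t in at 0. \<bar>s t\<bar> \<le> \<bar>t\<bar> \<and> \<bar>r t\<bar> \<le> \<bar>t\<bar>"
      using ev by eventually_elim (use sr in blast)
  qed
  moreover have "\<forall>\<^sub>F t in at 0. dirderiv (\<lambda>y. dirderiv f y v) (x + s t *\<^sub>R v + r t *\<^sub>R w) w = ?\<Delta> t / (t * t)"
    using ev
  proof eventually_elim
    case (elim t)
    then show ?case using sr[of t] by simp
  qed
  ultimately show ?thesis by (rule Lim_transform_eventually)
qed

lemma dirderiv_commute:
  assumes "smooth f" "x \<in> S" "v \<in> V" "w \<in> V"
  shows "dirderiv (\<lambda>y. dirderiv f y v) x w = dirderiv (\<lambda>y. dirderiv f y w) x v"
proof -
  have eq: "(\<lambda>t. (f (x + t *\<^sub>R w + t *\<^sub>R v) - f (x + t *\<^sub>R w) - f (x + t *\<^sub>R v) + f x) / (t * t))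
      = (\<lambda>t. (f (x + t *\<^sub>R v + t *\<^sub>R w) - f (x + t *\<^sub>R v) - f (x + t *\<^sub>R w) + f x) / (t * t))"
    by (rule ext) (simp add: ac_simps)
  show ?thesis
    by (rule tendsto_unique[OF trivial_limit_at double_difference_tendsto[OF assms]
          double_difference_tendsto[OF assms(1,2,4,3), unfolded eq]])
qed

end

text \<open>A device for proving smoothness: if the derivatives of the generators lie in the algebra
  again, then so does every iterated derivative, and continuity of the generators is enough.\<close>

inductive_set function_algebra :: "('a \<Rightarrow> real) set \<Rightarrow> ('a \<Rightarrow> real) set"
  for G :: "('a \<Rightarrow> real) set" where
  const: "(\<lambda>_. c) \<in> function_algebra G"
| gen: "g \<in> G \<Longrightarrow> g \<in> function_algebra G"
| add: "f \<in> function_algebra G \<Longrightarrow> g \<in> function_algebra G \<Longrightarrow> (\<lambda>x. f x + g x) \<in> function_algebra G"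
| mult: "f \<in> function_algebra G \<Longrightarrow> g \<in> function_algebra G \<Longrightarrow> (\<lambda>x. f x * g x) \<in> function_algebra G"

context relatively_open begin

lemma smooth_function_algebra:
  assumes cont: "\<And>g x. g \<in> G \<Longrightarrow> x \<in> S \<Longrightarrow> continuous (at x within S) g"
    and deriv: "\<And>g v. g \<in> G \<Longrightarrow> v \<in> V \<Longrightarrow> \<exists>g'\<in>function_algebra G. \<forall>x\<in>S.
      ((\<lambda>t. g (x + t *\<^sub>R v)) has_real_derivative g' x) (at 0)"
    and f: "f \<in> function_algebra G"
  shows "smooth f"
proof -
  have cont': "continuous (at x within S) g" if "g \<in> function_algebra G" "x \<in> S" for g x
    using that by (induction g rule: function_algebra.induct) (auto intro: continuous_const continuous_add continuous_mult cont)
  have deriv': "\<exists>g'\<in>function_algebra G. \<forall>x\<in>S. ((\<lambda>t. g (x + t *\<^sub>R v)) has_real_derivative g' x) (at 0)"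
    if "g \<in> function_algebra G" "v \<in> V" for g v
    using that
  proof (induction g rule: function_algebra.induct)
    case (const c)
    show ?case by (rule bexI[OF _ function_algebra.const[of 0]]) auto
  next
    case (gen g)
    then show ?case using deriv by blast
  next
    case (add f g)
    then obtain f' g' where "f' \<in> function_algebra G" "g' \<in> function_algebra G"
      "\<forall>x\<in>S. ((\<lambda>t. f (x + t *\<^sub>R v)) has_real_derivative f' x) (at 0)"
      "\<forall>x\<in>S. ((\<lambda>t. g (x + t *\<^sub>R v)) has_real_derivative g' x) (at 0)" by metis
    then show ?case
      by (intro bexI[of _ "\<lambda>x. f' x + g' x"]) (auto intro: function_algebra.add DERIV_add)
  next
    case (mult f g)
    then obtain f' g' where *: "f' \<in> function_algebra G" "g' \<in> function_algebra G"
      "\<forall>x\<in>S. ((\<lambda>t. f (x + t *\<^sub>R v)) has_real_derivative f' x) (at 0)"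
      "\<forall>x\<in>S. ((\<lambda>t. g (x + t *\<^sub>R v)) has_real_derivative g' x) (at 0)" by metis
    have "((\<lambda>t. f (x + t *\<^sub>R v) * g (x + t *\<^sub>R v)) has_real_derivative f' x * g x + g' x * f x) (at 0)"
      if "x \<in> S" for x
      using DERIV_mult[of "\<lambda>t. f (x + t *\<^sub>R v)" "f' x" 0 UNIV "\<lambda>t. g (x + t *\<^sub>R v)" "g' x"] * that by auto
    moreover have "(\<lambda>x. f' x * g x + g' x * f x) \<in> function_algebra G"
      using * mult by (intro function_algebra.add function_algebra.mult) auto
    ultimately show ?case by (intro bexI[of _ "\<lambda>x. f' x * g x + g' x * f x"] ballI)
  qed
  have iter: "\<exists>g\<in>function_algebra G. \<forall>x\<in>S. iter_dd f vs x = g x" if "set vs \<subseteq> V" for vs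
    using that
  proof (induction vs)
    case Nil
    then show ?case using f by auto
  next
    case (Cons v vs)
    then obtain g where g: "g \<in> function_algebra G" "\<forall>x\<in>S. iter_dd f vs x = g x" by auto
    obtain g' where g': "g' \<in> function_algebra G"
      "\<forall>x\<in>S. ((\<lambda>t. g (x + t *\<^sub>R v)) has_real_derivative g' x) (at 0)"
      using deriv' g(1) Cons.prems by (metis list.set_intros(1) subsetD)
    have "iter_dd f (v # vs) x = g' x" if x: "x \<in> S" for x
    proof -
      have "dirderiv (iter_dd f vs) x v = dirderiv g x v"
        using Cons.prems g x by (intro dirderiv_cong) auto
      also have "\<dots> = g' x" using g' x by (intro dirderiv_eqI) auto
      finally show ?thesis by simp
    qed
    then show ?case using g' by blast
  qed
  show ?thesis
    unfolding smooth_along_def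
  proof (intro allI impI ballI conjI)
    fix vs x assume vs: "set vs \<subseteq> V" and x: "x \<in> S"
    obtain g where g: "g \<in> function_algebra G" "\<And>x. x \<in> S \<Longrightarrow> iter_dd f vs x = g x"
      using iter vs by blast
    show "continuous (at x within S) (iter_dd f vs)"
      using cont'[OF g(1) x] g(2) x
      by (auto simp: continuous_within intro: Lim_transform_within[of _ _ _ _ 1])
    fix v assume v: "v \<in> V"
    obtain D where "((\<lambda>t. g (x + t *\<^sub>R v)) has_real_derivative D) (at 0)"
      using deriv'[OF g(1) v] x by blast
    then have "((\<lambda>t. iter_dd f vs (x + t *\<^sub>R v)) has_real_derivative D) (at 0)"
      using line_derivative_cong[OF x v, of "iter_dd f vs" g] g(2) by simp
    then show "((\<lambda>t. (iter_dd f vs (x + t *\<^sub>R v) - iter_dd f vs x) / t)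
        \<longlongrightarrow> dirderiv (iter_dd f vs) x v) (at 0)"
      by (simp add: dirderiv_eqI has_real_derivative_line_iff[symmetric])
  qed
qed

text \<open>With all smooth functions as generators, closure under sums and products follows without
  a Leibniz formula for higher derivatives.\<close>

lemma smooth_algebra_of_smooth:
  assumes "f \<in> function_algebra {g. smooth g}"
  shows "smooth f"
proof (rule smooth_function_algebra[OF _ _ assms])
  fix g v assume "g \<in> {g. smooth g}" "v \<in> V"
  then show "\<exists>g'\<in>function_algebra {g. smooth g}. \<forall>x\<in>S.
      ((\<lambda>t. g (x + t *\<^sub>R v)) has_real_derivative g' x) (at 0)"
    by (intro bexI[of _ "\<lambda>x. dirderiv g x v"])
      (auto intro: smooth_derivative function_algebra.gen smooth_dirderiv)
qed (auto intro: smooth_continuous)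

lemma smooth_const: "smooth (\<lambda>_. c)"
  by (rule smooth_algebra_of_smooth[OF function_algebra.const])

lemma smooth_add: "smooth f \<Longrightarrow> smooth g \<Longrightarrow> smooth (\<lambda>x. f x + g x)"
  by (auto intro!: smooth_algebra_of_smooth intro: function_algebra.intros)

lemma smooth_mult: "smooth f \<Longrightarrow> smooth g \<Longrightarrow> smooth (\<lambda>x. f x * g x)"
  by (auto intro!: smooth_algebra_of_smooth intro: function_algebra.intros)

lemma smooth_diff: "smooth f \<Longrightarrow> smooth g \<Longrightarrow> smooth (\<lambda>x. f x - g x)"
  using smooth_add[of f "\<lambda>x. -1 * g x"] smooth_mult[OF smooth_const[of "-1"], of g] by simp

lemma smooth_sum: "(\<And>i. i \<in> I \<Longrightarrow> smooth (f i)) \<Longrightarrow> smooth (\<lambda>x. \<Sum>i\<in>I. f i x)"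
  by (induction I rule: infinite_finite_induct) (auto intro: smooth_const smooth_add)

lemma smooth_linear:
  assumes "linear f"
  shows "smooth f"
proof (rule smooth_function_algebra[where G = "{f}"])
  show "continuous (at x within S) g" if "g \<in> {f}" for g x
    using assms that by (simp add: linear_continuous_within linear_linear)
  have "((\<lambda>t. f (x + t *\<^sub>R v)) has_real_derivative f v) (at 0)" for x v
    using assms by (auto simp: linear_add linear_scale intro!: derivative_eq_intros)
  then show "\<exists>g'\<in>function_algebra {f}. \<forall>x\<in>S. ((\<lambda>t. g (x + t *\<^sub>R v)) has_real_derivative g' x) (at 0)"
    if "g \<in> {f}" for g v
    using that by (intro bexI[OF _ function_algebra.const[of "f v"]]) auto
qed (auto intro: function_algebra.gen)

end

text \<open>No smoothness is involved: since L (x + t v) = L x + t L v, the difference quotients on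
  both sides are literally the same functions of t.\<close>

lemma iter_dd_compose_linear:
  assumes "linear L"
  shows "iter_dd (\<lambda>x. F (L x)) vs = (\<lambda>x. iter_dd F (map L vs) (L x))"
  by (induction vs) (auto simp: dirderiv_def linear_add[OF assms] linear_scale[OF assms])

lemma smooth_along_compose_linear:
  fixes L :: "'a::euclidean_space \<Rightarrow> 'b::euclidean_space"
  assumes "linear L" "L ` S \<subseteq> S'" "L ` V \<subseteq> V'" "smooth_along V' S' F"
  shows "smooth_along V S (\<lambda>x. F (L x))"
  unfolding smooth_along_def iter_dd_compose_linear[OF assms(1)]
proof (intro allI impI ballI conjI)
  fix vs x assume vs: "set vs \<subseteq> V" and x: "x \<in> S"
  have vs': "set (map L vs) \<subseteq> V'" and x': "L x \<in> S'" using vs x assms by auto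
  note * = assms(4)[unfolded smooth_along_def, rule_format, OF vs' x']
  show "continuous (at x within S) (\<lambda>x. iter_dd F (map L vs) (L x))"
  proof (rule continuous_within_compose2[where g = "iter_dd F (map L vs)"])
    show "continuous (at x within S) L"
      using assms(1) by (simp add: linear_continuous_within linear_linear)
    show "continuous (at (L x) within L ` S) (iter_dd F (map L vs))"
      using * assms(2) by (blast intro: continuous_within_subset)
  qed
  fix v assume "v \<in> V"
  then have "L v \<in> V'" using assms by auto
  with * show "((\<lambda>t. (iter_dd F (map L vs) (L (x + t *\<^sub>R v)) - iter_dd F (map L vs) (L x)) / t)
      \<longlongrightarrow> dirderiv (\<lambda>x. iter_dd F (map L vs) (L x)) x v) (at 0)"
    by (simp add: dirderiv_def linear_add[OF assms(1)] linear_scale[OF assms(1)])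
qed

text \<open>Turns a bracket into a finite sum of products of scalar functions, which can be
  differentiated term by term.\<close>

lemma bilinear_Basis_expansion:
  fixes B :: "'a::euclidean_space \<Rightarrow> 'a \<Rightarrow> real"
  assumes "bilinear B"
  shows "B u w = (\<Sum>b\<in>Basis. \<Sum>b'\<in>Basis. (u \<bullet> b) * (w \<bullet> b') * B b b')"
proof -
  have "B u w = B (\<Sum>b\<in>Basis. (u \<bullet> b) *\<^sub>R b) (\<Sum>b'\<in>Basis. (w \<bullet> b') *\<^sub>R b')"
    by (simp add: euclidean_representation)
  also have "\<dots> = (\<Sum>(b,b')\<in>Basis \<times> Basis. B ((u \<bullet> b) *\<^sub>R b) ((w \<bullet> b') *\<^sub>R b'))"
    using assms by (intro bilinear_sum) auto
  finally show ?thesis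
    using assms by (simp add: sum.cartesian_product bilinear_lmul bilinear_rmul split_def mult.assoc)
qed

subsection \<open>Gradients and brackets of bivectors\<close>

text \<open>\<open>P\<close> is the orthogonal projection onto \<open>V\<close>: the Hermitian
  projection of J for the slice, the identity for the whole phase space.\<close>

locale projected_open = relatively_open V S for V S :: "'a::euclidean_space set" +
  fixes P :: "'a \<Rightarrow> 'a"
  assumes linear_P: "linear P" and P_in: "P x \<in> V" and P_id: "v \<in> V \<Longrightarrow> P v = v"
    and P_selfadjoint: "P x \<bullet> y = x \<bullet> P y"
begin

text \<open>Derivatives are taken only in the directions \<open>P b\<close>, the ones in which f is
  controlled; the outer \<open>P\<close> selects the representative of the differential inside
  \<open>V\<close>.\<close>

definition grad :: "('a \<Rightarrow> real) \<Rightarrow> 'a \<Rightarrow> 'a" where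
  "grad f x = P (\<Sum>b\<in>Basis. dirderiv f x (P b) *\<^sub>R b)"

lemma grad_in: "grad f x \<in> V"
  by (simp add: grad_def P_in)

lemma inner_grad_P: "grad f x \<bullet> w = grad f x \<bullet> P w"
  by (metis P_id P_selfadjoint grad_in)

lemma inner_grad:
  assumes "smooth f" "x \<in> S" "v \<in> V"
  shows "grad f x \<bullet> v = dirderiv f x v"
proof -
  have "dirderiv f x v = dirderiv f x (P (\<Sum>b\<in>Basis. (v \<bullet> b) *\<^sub>R b))"
    using assms by (simp add: euclidean_representation P_id)
  also have "\<dots> = dirderiv f x (\<Sum>b\<in>Basis. (v \<bullet> b) *\<^sub>R P b)"
    using linear_P by (simp add: linear_sum linear_scale)
  also have "\<dots> = (\<Sum>b\<in>Basis. (v \<bullet> b) * dirderiv f x (P b))"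
    using assms by (intro dirderiv_sum P_in) auto
  also have "\<dots> = grad f x \<bullet> v"
    unfolding grad_def P_selfadjoint P_id[OF assms(3)]
    by (simp add: inner_sum_left inner_commute[of v] mult.commute)
  finally show ?thesis ..
qed

lemma grad_eqI:
  assumes "u \<in> V" "smooth f" "x \<in> S" "\<And>v. v \<in> V \<Longrightarrow> u \<bullet> v = dirderiv f x v"
  shows "grad f x = u"
proof -
  have "grad f x - u \<in> V" using grad_in assms subspace_V by (simp add: subspace_diff)
  then have "(grad f x - u) \<bullet> (grad f x - u) = 0"
    using assms inner_grad by (simp add: inner_diff_left)
  then show ?thesis by simp
qed

lemma grad_lincomb:
  assumes "smooth f" "smooth g" "x \<in> S"
  shows "grad (\<lambda>y. a * f y + b * g y) x = a *\<^sub>R grad f x + b *\<^sub>R grad g x"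
proof (rule grad_eqI)
  show "a *\<^sub>R grad f x + b *\<^sub>R grad g x \<in> V" by (simp add: V_add V_scale grad_in)
  show "smooth (\<lambda>y. a * f y + b * g y)" by (intro smooth_add smooth_mult smooth_const assms)
  fix v assume v: "v \<in> V"
  have "dirderiv (\<lambda>y. a * f y + b * g y) x v = a * dirderiv f x v + b * dirderiv g x v"
    by (intro dirderiv_eqI DERIV_add DERIV_cmult smooth_derivative assms v)
  then show "(a *\<^sub>R grad f x + b *\<^sub>R grad g x) \<bullet> v = dirderiv (\<lambda>y. a * f y + b * g y) x v"
    using assms v by (simp add: inner_add_left inner_grad)
qed fact

lemma grad_mult:
  assumes "smooth f" "smooth g" "x \<in> S"
  shows "grad (\<lambda>y. f y * g y) x = g x *\<^sub>R grad f x + f x *\<^sub>R grad g x"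
proof (rule grad_eqI)
  show "g x *\<^sub>R grad f x + f x *\<^sub>R grad g x \<in> V" by (simp add: V_add V_scale grad_in)
  show "smooth (\<lambda>y. f y * g y)" by (intro smooth_mult assms)
  fix v assume v: "v \<in> V"
  have "dirderiv (\<lambda>y. f y * g y) x v = dirderiv f x v * g x + dirderiv g x v * f x"
    using DERIV_mult[OF smooth_derivative[OF assms(1,3) v] smooth_derivative[OF assms(2,3) v]]
    by (intro dirderiv_eqI) simp
  then show "(g x *\<^sub>R grad f x + f x *\<^sub>R grad g x) \<bullet> v = dirderiv (\<lambda>y. f y * g y) x v"
    using assms v by (simp add: inner_add_left inner_grad)
qed fact

lemma smooth_grad_component:
  assumes "smooth f"
  shows "smooth (\<lambda>x. grad f x \<bullet> b)"
proof (rule smooth_cong)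
  show "smooth (\<lambda>x. dirderiv f x (P b))" using assms P_in by (rule smooth_dirderiv)
  show "dirderiv f x (P b) = grad f x \<bullet> b" if "x \<in> S" for x
    using inner_grad[OF assms that P_in] inner_grad_P[of f x b] by simp
qed

text \<open>Symmetry of second derivatives in gradient form: differentiating the gradient along v
  gives the gradient of the derivative along v.\<close>

lemma grad_component_derivative:
  assumes "smooth f" "x \<in> S" "v \<in> V"
  shows "((\<lambda>t. grad f (x + t *\<^sub>R v) \<bullet> b) has_real_derivative grad (\<lambda>y. dirderiv f y v) x \<bullet> b) (at 0)"
proof -
  have eq: "grad f y \<bullet> b = dirderiv f y (P b)" if "y \<in> S" for y
    using inner_grad[OF assms(1) that P_in] inner_grad_P[of f y b] by simp
  have "((\<lambda>t. dirderiv f (x + t *\<^sub>R v) (P b)) has_real_derivative dirderiv (\<lambda>y. dirderiv f y (P b)) x v) (at 0)"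
    by (intro smooth_derivative smooth_dirderiv assms P_in)
  moreover have "dirderiv (\<lambda>y. dirderiv f y (P b)) x v = grad (\<lambda>y. dirderiv f y v) x \<bullet> b"
    by (subst inner_grad_P, subst inner_grad)
      (use assms in \<open>auto intro: smooth_dirderiv P_in dirderiv_commute\<close>)
  ultimately show ?thesis
    using line_derivative_cong[OF assms(2,3), of "\<lambda>y. grad f y \<bullet> b" "\<lambda>y. dirderiv f y (P b)"] eq by simp
qed

text \<open>Chain rule for a curve x + w t leaving x, needed because torus orbits are not straight
  lines. The mean value theorem on the chord from x to x + w t gives a gradient at an intermediate
  point, and gradients are continuous.\<close>

lemma curve_quotient_tendsto:
  assumes "smooth f" "x \<in> S" "\<And>t. w t \<in> V"
    and w: "((\<lambda>t. (1/t) *\<^sub>R w t) \<longlongrightarrow> w') (at (0::real))"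
  shows "((\<lambda>t. (f (x + w t) - f x) / t) \<longlongrightarrow> grad f x \<bullet> w') (at 0)"
proof -
  obtain e where e: "e > 0" "\<And>v. v \<in> V \<Longrightarrow> norm v < e \<Longrightarrow> x + v \<in> S"
    using rel_open assms(2) by blast
  have "((\<lambda>t. t *\<^sub>R ((1/t) *\<^sub>R w t)) \<longlongrightarrow> 0 *\<^sub>R w') (at 0)"
    by (intro tendsto_intros w)
  moreover have ne: "\<forall>\<^sub>F t in at (0::real). t \<noteq> 0"
    by (auto simp: eventually_at intro!: exI[of _ 1])
  ultimately have w0: "(w \<longlongrightarrow> 0) (at 0)"
    by (auto elim!: Lim_transform_eventually eventually_mono)
  then have small: "\<forall>\<^sub>F t in at 0. norm (w t) < e"
    using e(1) tendstoD by fastforce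
  have seg: "x + s *\<^sub>R w t \<in> S" if "norm (w t) < e" "\<bar>s\<bar> \<le> 1" for s t
  proof -
    have "norm (s *\<^sub>R w t) \<le> 1 * norm (w t)" using that by (simp add: mult_left_le_one_le)
    then show ?thesis using that e(2) V_scale assms(3) by simp
  qed
  have "\<forall>t. \<exists>s. norm (w t) < e \<longrightarrow> \<bar>s\<bar> \<le> 1 \<and> f (x + w t) - f x = grad f (x + s *\<^sub>R w t) \<bullet> w t"
  proof
    fix t
    show "\<exists>s. norm (w t) < e \<longrightarrow> \<bar>s\<bar> \<le> 1 \<and> f (x + w t) - f x = grad f (x + s *\<^sub>R w t) \<bullet> w t"
    proof (cases "norm (w t) < e")
      case True
      then obtain s where "\<bar>s\<bar> \<le> \<bar>1\<bar>" "f (x + 1 *\<^sub>R w t) - f x = 1 * dirderiv f (x + s *\<^sub>R w t) (w t)"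
        using mvt_line[OF assms(1) assms(3)[of t], of 1 x] seg[OF True] by auto
      then show ?thesis using seg[OF True] assms(1,3) by (auto simp: inner_grad intro!: exI[of _ s])
    qed auto
  qed
  then obtain s where s: "\<And>t. norm (w t) < e \<Longrightarrow> \<bar>s t\<bar> \<le> 1 \<and> f (x + w t) - f x = grad f (x + s t *\<^sub>R w t) \<bullet> w t"
    unfolding choice_iff by blast
  have "((\<lambda>t. s t *\<^sub>R w t) \<longlongrightarrow> 0) (at 0)"
  proof (rule Lim_null_comparison[where g = "\<lambda>t. norm (w t)"])
    show "\<forall>\<^sub>F t in at 0. norm (s t *\<^sub>R w t) \<le> norm (w t)"
      using small by eventually_elim (use s in \<open>simp add: mult_left_le_one_le\<close>)
    show "((\<lambda>t. norm (w t)) \<longlongrightarrow> 0) (at 0)" using w0 by (rule tendsto_norm_zero)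
  qed
  from tendsto_add[OF tendsto_const this] have y: "((\<lambda>t. x + s t *\<^sub>R w t) \<longlongrightarrow> x) (at 0)" by simp
  have yS: "\<forall>\<^sub>F t in at 0. x + s t *\<^sub>R w t \<in> S"
    using small by eventually_elim (use s seg in blast)
  have "((\<lambda>t. grad f (x + s t *\<^sub>R w t) \<bullet> b) \<longlongrightarrow> grad f x \<bullet> b) (at 0)" for b
    by (rule continuous_within_tendsto_compose[OF _ yS y])
      (intro smooth_continuous smooth_grad_component assms)
  then have "((\<lambda>t. \<Sum>b\<in>Basis. (grad f (x + s t *\<^sub>R w t) \<bullet> b) * (((1/t) *\<^sub>R w t) \<bullet> b))
      \<longlongrightarrow> (\<Sum>b\<in>Basis. (grad f x \<bullet> b) * (w' \<bullet> b))) (at 0)"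
    by (intro tendsto_sum tendsto_mult tendsto_inner[OF w tendsto_const])
  then have "((\<lambda>t. grad f (x + s t *\<^sub>R w t) \<bullet> ((1/t) *\<^sub>R w t)) \<longlongrightarrow> grad f x \<bullet> w') (at 0)"
    by (simp only: euclidean_inner[symmetric])
  then show ?thesis
  proof (rule Lim_transform_eventually)
    show "\<forall>\<^sub>F t in at 0. grad f (x + s t *\<^sub>R w t) \<bullet> ((1/t) *\<^sub>R w t) = (f (x + w t) - f x) / t"
      using small by eventually_elim (use s in simp)
  qed
qed

lemma grad_cong:
  assumes "x \<in> S" "\<And>y. y \<in> S \<Longrightarrow> f y = g y"
  shows "grad f x = grad g x"
  unfolding grad_def using dirderiv_cong[OF assms(1) P_in assms(2)] by simp

end

text \<open>\<open>d\<pi>\<close> differentiates the coefficients with the two covectors frozen, and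
  \<open>X x \<alpha>\<close> is the vector obtained by contracting the first slot, so that {f, g}
  is the derivative of g along \<open>X x (grad f x)\<close>.\<close>

locale bivector = projected_open V S P for V S :: "'a::euclidean_space set" and P +
  fixes \<pi> :: "'a \<Rightarrow> 'a \<Rightarrow> 'a \<Rightarrow> real"
    and d\<pi> :: "'a \<Rightarrow> 'a \<Rightarrow> 'a \<Rightarrow> 'a \<Rightarrow> real"
    and X :: "'a \<Rightarrow> 'a \<Rightarrow> 'a"
  assumes bilinear_\<pi>: "bilinear (\<pi> x)" and bilinear_d\<pi>: "bilinear (d\<pi> x v)"
    and antisym: "\<pi> x \<alpha> \<beta> = - \<pi> x \<beta> \<alpha>"
    and smooth_\<pi>: "smooth (\<lambda>x. \<pi> x \<alpha> \<beta>)"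
    and deriv_\<pi>: "x \<in> S \<Longrightarrow> v \<in> V \<Longrightarrow>
      ((\<lambda>t. \<pi> (x + t *\<^sub>R v) \<alpha> \<beta>) has_real_derivative d\<pi> x v \<alpha> \<beta>) (at 0)"
    and X_in: "x \<in> S \<Longrightarrow> \<alpha> \<in> V \<Longrightarrow> X x \<alpha> \<in> V"
    and inner_X: "x \<in> S \<Longrightarrow> \<alpha> \<in> V \<Longrightarrow> \<beta> \<in> V \<Longrightarrow> X x \<alpha> \<bullet> \<beta> = \<pi> x \<alpha> \<beta>"
begin

definition bracket :: "('a \<Rightarrow> real) \<Rightarrow> ('a \<Rightarrow> real) \<Rightarrow> 'a \<Rightarrow> real" where
  "bracket f g x = \<pi> x (grad f x) (grad g x)"

lemma bracket_expansion:
  "bracket f g = (\<lambda>x. \<Sum>b\<in>Basis. \<Sum>b'\<in>Basis. (grad f x \<bullet> b) * (grad g x \<bullet> b') * \<pi> x b b')"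
  unfolding bracket_def by (intro ext bilinear_Basis_expansion bilinear_\<pi>)

lemma smooth_bracket:
  assumes "smooth f" "smooth g"
  shows "smooth (bracket f g)"
  unfolding bracket_expansion
  by (intro smooth_sum smooth_mult smooth_grad_component smooth_\<pi> assms)

lemma bracket_antisym: "bracket f g x = - bracket g f x"
  unfolding bracket_def by (rule antisym)

lemma bracket_lincomb:
  assumes "smooth f" "smooth g" "x \<in> S"
  shows "bracket (\<lambda>y. a * f y + b * g y) h x = a * bracket f h x + b * bracket g h x"
  unfolding bracket_def
  by (simp add: grad_lincomb[OF assms] bilinear_ladd[OF bilinear_\<pi>] bilinear_lmul[OF bilinear_\<pi>])

lemma bracket_leibniz:
  assumes "smooth g" "smooth h" "x \<in> S"
  shows "bracket f (\<lambda>y. g y * h y) x = bracket f g x * h x + g x * bracket f h x"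
  unfolding bracket_def
  by (simp add: grad_mult[OF assms] bilinear_radd[OF bilinear_\<pi>] bilinear_rmul[OF bilinear_\<pi>])

lemma dirderiv_bracket:
  assumes "smooth f" "smooth g" "x \<in> S" "v \<in> V"
  shows "dirderiv (bracket f g) x v = d\<pi> x v (grad f x) (grad g x)
    + \<pi> x (grad (\<lambda>y. dirderiv f y v) x) (grad g x) + \<pi> x (grad f x) (grad (\<lambda>y. dirderiv g y v) x)"
proof (rule dirderiv_eqI)
  let ?F = "grad (\<lambda>y. dirderiv f y v) x" and ?G = "grad (\<lambda>y. dirderiv g y v) x"
  have "((\<lambda>t. \<Sum>b\<in>Basis. \<Sum>b'\<in>Basis. (grad f (x + t *\<^sub>R v) \<bullet> b) * (grad g (x + t *\<^sub>R v) \<bullet> b') * \<pi> (x + t *\<^sub>R v) b b')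
    has_real_derivative (\<Sum>b\<in>Basis. \<Sum>b'\<in>Basis. (grad f x \<bullet> b) * (grad g x \<bullet> b') * d\<pi> x v b b' +
      (?F \<bullet> b) * (grad g x \<bullet> b') * \<pi> x b b' + (grad f x \<bullet> b) * (?G \<bullet> b') * \<pi> x b b')) (at 0)"
  proof (intro DERIV_sum, goal_cases)
    case (1 b b')
    note d = DERIV_mult[OF DERIV_mult[OF grad_component_derivative[OF assms(1,3,4), of b]
          grad_component_derivative[OF assms(2,3,4), of b']] deriv_\<pi>[OF assms(3,4), of b b']]
    show ?case
      by (rule DERIV_cong[OF d]) (simp add: algebra_simps)
  qed
  then show "((\<lambda>t. bracket f g (x + t *\<^sub>R v)) has_real_derivative d\<pi> x v (grad f x) (grad g x)
      + \<pi> x ?F (grad g x) + \<pi> x (grad f x) ?G) (at 0)"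
    unfolding bracket_expansion
    by (subst bilinear_Basis_expansion[OF bilinear_d\<pi>], subst (2 3) bilinear_Basis_expansion[OF bilinear_\<pi>])
       (simp add: sum.distrib)
qed

text \<open>The second-derivative terms cancel in the cyclic sum because Hessians are symmetric, so only
  the Schouten bracket of the bivector with itself, evaluated on the three gradients, survives.\<close>

lemma bracket_jacobi:
  assumes "smooth f" "smooth g" "smooth h" "x \<in> S"
    and schouten: "d\<pi> x (X x (grad f x)) (grad g x) (grad h x) + d\<pi> x (X x (grad g x)) (grad h x) (grad f x)
      + d\<pi> x (X x (grad h x)) (grad f x) (grad g x) = 0"
  shows "bracket f (bracket g h) x + bracket g (bracket h f) x + bracket h (bracket f g) x = 0"
proof -
  let ?X = "\<lambda>f. X x (grad f x)"
  let ?D2 = "\<lambda>f v w. dirderiv (\<lambda>y. dirderiv f y v) x w"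
  have Xin: "?X f \<in> V" for f by (simp add: X_in assms grad_in)
  \<comment> \<open>The derivative along the Hamiltonian vector of f hits the coefficients, dg and
    dh; the last two contributions are Hessians evaluated on two Hamiltonian vectors.\<close>
  have *: "bracket f (bracket g h) x = d\<pi> x (?X f) (grad g x) (grad h x)
      - ?D2 g (?X f) (?X h) + ?D2 h (?X f) (?X g)" if s: "smooth f" "smooth g" "smooth h" for f g h
  proof -
    have pair: "\<pi> x (grad k x) (grad (\<lambda>y. dirderiv l y (?X f)) x) = ?D2 l (?X f) (?X k)"
      if "smooth l" for k l
    proof -
      have "\<pi> x (grad k x) (grad (\<lambda>y. dirderiv l y (?X f)) x) = ?X k \<bullet> grad (\<lambda>y. dirderiv l y (?X f)) x"
        by (simp add: inner_X assms grad_in)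
      also have "\<dots> = ?D2 l (?X f) (?X k)"
        by (subst inner_commute) (simp add: inner_grad smooth_dirderiv that assms Xin)
      finally show ?thesis .
    qed
    have "bracket f (bracket g h) x = ?X f \<bullet> grad (bracket g h) x"
      by (simp add: bracket_def inner_X assms grad_in)
    also have "\<dots> = dirderiv (bracket g h) x (?X f)"
      by (subst inner_commute) (simp add: inner_grad smooth_bracket s assms Xin)
    also have "\<dots> = d\<pi> x (?X f) (grad g x) (grad h x)
      - ?D2 g (?X f) (?X h) + ?D2 h (?X f) (?X g)"
      using pair[OF s(3), of g] pair[OF s(2), of h]
      by (simp add: dirderiv_bracket s assms Xin antisym[of x _ "grad h x"])
    finally show ?thesis .
  qed
  have comm: "?D2 k (?X l) (?X m) = ?D2 k (?X m) (?X l)" if "smooth k" for k l m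
    by (intro dirderiv_commute that assms Xin)
  show ?thesis
    using schouten comm[OF assms(1), of g h] comm[OF assms(2), of f h] comm[OF assms(3), of f g]
    by (simp add: *[OF assms(1,2,3)] *[OF assms(2,3,1)] *[OF assms(3,1,2)])
qed

end

subsection \<open>Matrices and the trace form\<close>

lemma adj_adj [simp]: "adj (adj X) = X"
  and adj_add: "adj (X + Y) = adj X + adj Y"
  and adj_diff: "adj (X - Y) = adj X - adj Y"
  and adj_zero [simp]: "adj 0 = 0"
  and adj_scaleR: "adj (c *\<^sub>R X) = c *\<^sub>R adj X"
  by (simp_all add: adj_def vec_eq_iff)

lemma adj_mult: "adj (X ** Y) = adj Y ** adj X"
  by (simp add: adj_def vec_eq_iff matrix_matrix_mult_def mult.commute)

lemma matrix_minus_left: "(- A) ** B = - (A ** B)"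
  and matrix_minus_right: "A ** (- B) = - (A ** B)"
  for A B :: "complex^'n::finite^'n"
  by (simp_all add: vec_eq_iff matrix_matrix_mult_def sum_negf)

lemma matrix_diff_left: "(A - B) ** C = A ** C - B ** C"
  and matrix_diff_right: "C ** (A - B) = C ** A - C ** B"
  and matrix_add_left: "(A + B) ** C = A ** C + B ** C"
  for A B C :: "complex^'n::finite^'n"
  by (simp_all add: vec_eq_iff matrix_matrix_mult_def algebra_simps sum_subtractf sum.distrib)

lemma matrix_scaleR_left: "(c *\<^sub>R A) ** B = c *\<^sub>R (A ** B)"
  and matrix_scaleR_right: "A ** (c *\<^sub>R B) = c *\<^sub>R (A ** B)"
  for A B :: "complex^'n::finite^'n"
  by (simp_all add: vec_eq_iff matrix_matrix_mult_def scaleR_sum_right)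

lemmas matrix_ring = matrix_add_ldistrib matrix_add_left matrix_diff_left matrix_diff_right
  matrix_minus_left matrix_minus_right matrix_scaleR_left matrix_scaleR_right

lemma ip_sum: "ip X Y = (\<Sum>i\<in>UNIV. \<Sum>j\<in>UNIV. Re (X $ i $ j * Y $ j $ i))"
  by (simp add: ip_def mtrace_def matrix_matrix_mult_def)

lemma ip_commute: "ip X Y = ip Y X"
  unfolding ip_sum by (subst sum.swap) (simp add: mult.commute)

lemma ip_linear:
  "ip (X + Y) Z = ip X Z + ip Y Z" "ip Z (X + Y) = ip Z X + ip Z Y"
  "ip (X - Y) Z = ip X Z - ip Y Z" "ip Z (X - Y) = ip Z X - ip Z Y"
  "ip (- X) Z = - ip X Z" "ip Z (- X) = - ip Z X"
  "ip (c *\<^sub>R X) Z = c * ip X Z" "ip Z (c *\<^sub>R X) = c * ip Z X"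
  "ip 0 X = 0" "ip X 0 = 0"
  by (simp_all add: ip_sum algebra_simps sum.distrib sum_subtractf sum_negf sum_distrib_left)

lemma ip_assoc: "ip (X ** Y) Z = ip X (Y ** Z)"
  by (simp add: ip_def matrix_mul_assoc)

lemma ip_rotate: "ip X (Y ** Z) = ip Y (Z ** X)"
  by (metis ip_assoc ip_commute)

text \<open>The trace of X^* Y^* is the conjugate of the trace of Y X, and the form keeps only real
  parts.\<close>

lemma ip_adj: "ip (adj X) (adj Y) = ip X Y"
  by (subst ip_commute) (simp add: ip_sum adj_def mult.commute)

lemma ip_adj_left: "ip (adj X) Y = ip X (adj Y)"
  using ip_adj[of X "adj Y"] by simp

lemma ip_triple:
  "ip (X ** Y) Z = (\<Sum>i\<in>UNIV. \<Sum>j\<in>UNIV. \<Sum>k\<in>UNIV. Re (X $ i $ j * Y $ j $ k * Z $ k $ i))"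
proof -
  have "ip (X ** Y) Z = (\<Sum>i\<in>UNIV. \<Sum>k\<in>UNIV. \<Sum>j\<in>UNIV. Re (X $ i $ j * Y $ j $ k * Z $ k $ i))"
    by (simp only: ip_sum matrix_matrix_mult_def vec_lambda_beta sum_distrib_right Re_sum)
  also have "\<dots> = (\<Sum>i\<in>UNIV. \<Sum>j\<in>UNIV. \<Sum>k\<in>UNIV. Re (X $ i $ j * Y $ j $ k * Z $ k $ i))"
    by (intro sum.cong refl sum.swap)
  finally show ?thesis .
qed

lemma adj_mminus: "adj (mminus X) = mminus X"
  by (simp add: mminus_def adj_scaleR adj_add add.commute)

lemma mplus_eq_0_iff: "mplus J = 0 \<longleftrightarrow> adj J = J"
  by (auto simp: mplus_def)

lemma mminus_id: "adj A = A \<Longrightarrow> mminus A = A"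
  by (simp add: mminus_def flip: scaleR_2)

lemma ip_mminus: "ip (mminus Y) Z = (ip Y Z + ip (adj Y) Z) / 2"
  by (simp add: mminus_def ip_linear)

lemma ip_mminus_herm: "adj Z = Z \<Longrightarrow> ip (mminus Y) Z = ip Y Z"
  by (simp add: ip_mminus ip_adj_left)

subsection \<open>The dynamical r-matrix\<close>

definition coth_diff :: "real^'n \<Rightarrow> 'n \<Rightarrow> 'n \<Rightarrow> real" where
  "coth_diff q i j = (if i = j then 0 else cosh (q $ i - q $ j) / sinh (q $ i - q $ j))"

text \<open>The derivative of \<open>Rq q X\<close> as q moves along \<xi>, from coth' = 1 - coth^2.
  The diagonal needs no case split, since \<xi>_i - \<xi>_j vanishes there.\<close>

definition dRq :: "real^'n \<Rightarrow> real^'n \<Rightarrow> 'n::finite mat \<Rightarrow> 'n mat" where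
  "dRq q \<xi> X = (\<chi> i j. X $ i $ j * complex_of_real ((1 - (coth_diff q i j)\<^sup>2) * (\<xi> $ i - \<xi> $ j)))"

lemma Rq_nth: "Rq q X $ i $ j = X $ i $ j * complex_of_real (coth_diff q i j)"
  by (simp add: Rq_def coth_diff_def)

lemma coth_diff_swap: "coth_diff q j i = - coth_diff q i j"
proof -
  have "sinh (q $ j - q $ i) = - sinh (q $ i - q $ j)" "cosh (q $ j - q $ i) = cosh (q $ i - q $ j)"
    by (metis minus_diff_eq sinh_minus, metis minus_diff_eq cosh_minus)
  then show ?thesis by (simp add: coth_diff_def)
qed

lemma Rq_linear:
  "Rq q (X + Y) = Rq q X + Rq q Y" "Rq q (X - Y) = Rq q X - Rq q Y" "Rq q (- X) = - Rq q X"
  "Rq q (c *\<^sub>R X) = c *\<^sub>R Rq q X"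
  by (simp_all add: vec_eq_iff Rq_nth algebra_simps)

lemma dRq_linear:
  "dRq q \<xi> (X + Y) = dRq q \<xi> X + dRq q \<xi> Y" "dRq q \<xi> (c *\<^sub>R X) = c *\<^sub>R dRq q \<xi> X"
  "dRq q (\<xi> + \<eta>) X = dRq q \<xi> X + dRq q \<eta> X" "dRq q (c *\<^sub>R \<xi>) X = c *\<^sub>R dRq q \<xi> X"
  by (simp_all add: vec_eq_iff dRq_def algebra_simps scaleR_conv_of_real[where 'a = complex])

text \<open>Oddness of coth. As a consequence R(q) maps Hermitian matrices to anti-Hermitian ones
  and conversely.\<close>

lemma adj_Rq: "adj (Rq q X) = - Rq q (adj X)"
proof -
  have "adj (Rq q X) $ i $ j = (- Rq q (adj X)) $ i $ j" for i j
    using coth_diff_swap[of q j i] by (simp add: Rq_nth adj_def)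
  then show ?thesis by (simp add: vec_eq_iff)
qed

lemma adj_dRq: "adj (dRq q \<xi> X) = - dRq q \<xi> (adj X)"
proof -
  define r where "r i j = (1 - (coth_diff q i j)\<^sup>2) * (\<xi> $ i - \<xi> $ j)" for i j
  have r: "r j i = - r i j" for i j
    unfolding r_def by (subst coth_diff_swap) (simp add: algebra_simps)
  have nth: "dRq q \<xi> X $ i $ j = X $ i $ j * complex_of_real (r i j)" for X i j
    by (simp add: dRq_def r_def)
  have "adj (dRq q \<xi> X) $ i $ j = (- dRq q \<xi> (adj X)) $ i $ j" for i j
    using r[of j i] by (simp add: nth adj_def)
  then show ?thesis by (simp add: vec_eq_iff)
qed

lemma ip_Rq: "ip X (Rq q Y) = - ip (Rq q X) Y"
proof -
  have "Re (X $ i $ j * (Y $ j $ i * complex_of_real (coth_diff q j i)))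
      = - Re (X $ i $ j * complex_of_real (coth_diff q i j) * Y $ j $ i)" for i j
    by (subst coth_diff_swap) (simp add: algebra_simps)
  then show ?thesis by (simp only: ip_sum Rq_nth sum_negf)
qed

lemma ip_herm_antiherm: "adj X = X \<Longrightarrow> adj Y = - Y \<Longrightarrow> ip X Y = 0"
  using ip_adj[of X Y] by (simp add: ip_linear)

lemma ip_dRq_herm: "adj A = A \<Longrightarrow> adj B = B \<Longrightarrow> ip A (dRq q \<xi> B) = 0"
  by (rule ip_herm_antiherm) (simp_all add: adj_dRq)

section \<open>The functional equation of coth and the dynamical Yang-Baxter equation\<close>

lemma coth_addition:
  fixes u v w :: real
  assumes "u + v + w = 0" "u \<noteq> 0" "v \<noteq> 0" "w \<noteq> 0"
  shows "cosh u / sinh u * (cosh v / sinh v) + cosh v / sinh v * (cosh w / sinh w)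
    + cosh w / sinh w * (cosh u / sinh u) = -1"
proof -
  have w: "w = - (u + v)" using assms by simp
  have sw: "sinh w = - (sinh u * cosh v + cosh u * sinh v)" unfolding w sinh_minus sinh_add by simp
  have cw: "cosh w = cosh u * cosh v + sinh u * sinh v" unfolding w cosh_minus cosh_add by simp
  have nz: "sinh u \<noteq> 0" "sinh v \<noteq> 0" "sinh w \<noteq> 0" using assms by auto
  have "cosh u * cosh v * sinh w + cosh v * cosh w * sinh u + cosh w * cosh u * sinh v
      = - (sinh u * sinh v * sinh w)"
    unfolding sw cw by (simp add: algebra_simps)
  then show ?thesis using nz by (simp add: field_simps)
qed

text \<open>For distinct indices this is the addition theorem. The corrections come from the value 0
  at coinciding indices: if only i = j, the surviving product is -coth^2; if all three agree, each
  correction contributes 1, and the final 2 restores the total 0.\<close>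

lemma coth_diff_cyclic:
  assumes "inj (($) q)"
  shows "coth_diff q i j * coth_diff q j k + coth_diff q j k * coth_diff q k i + coth_diff q k i * coth_diff q i j
    = -1 + (if i = j then 1 - (coth_diff q j k)\<^sup>2 else 0) + (if j = k then 1 - (coth_diff q k i)\<^sup>2 else 0)
      + (if k = i then 1 - (coth_diff q i j)\<^sup>2 else 0) - (if i = j \<and> j = k then 2 else 0)"
proof (cases "i \<noteq> j \<and> j \<noteq> k \<and> k \<noteq> i")
  case True
  then have "q $ i \<noteq> q $ j" "q $ j \<noteq> q $ k" "q $ k \<noteq> q $ i" using assms by (auto dest: injD)
  then show ?thesis
    using True coth_addition[of "q $ i - q $ j" "q $ j - q $ k" "q $ k - q $ i"]
    by (simp add: coth_diff_def)
next
  case False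
  have z: "coth_diff q l l = 0" for l by (simp add: coth_diff_def)
  show ?thesis
    using False coth_diff_swap[of q j i] coth_diff_swap[of q k j] coth_diff_swap[of q i k]
    by (auto simp: z power2_eq_square)
qed

lemma sum_rotate3: "(\<Sum>i\<in>A. \<Sum>j\<in>A. \<Sum>k\<in>A. F i j k) = (\<Sum>i\<in>A. \<Sum>j\<in>A. \<Sum>k\<in>A. F j k i)"
  for F :: "'a \<Rightarrow> 'a \<Rightarrow> 'a \<Rightarrow> 'b::comm_monoid_add"
proof -
  have "(\<Sum>i\<in>A. \<Sum>j\<in>A. \<Sum>k\<in>A. F i j k) = (\<Sum>i\<in>A. \<Sum>k\<in>A. \<Sum>j\<in>A. F i j k)"
    by (intro sum.cong refl sum.swap)
  also have "\<dots> = (\<Sum>k\<in>A. \<Sum>i\<in>A. \<Sum>j\<in>A. F i j k)" by (rule sum.swap)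
  finally show ?thesis .
qed

lemma sum_antisym_zero:
  fixes h :: "'a \<Rightarrow> 'a \<Rightarrow> real"
  assumes "\<And>i j. h j i = - h i j"
  shows "(\<Sum>i\<in>A. \<Sum>j\<in>A. h i j) = 0"
proof -
  have "(\<Sum>i\<in>A. \<Sum>j\<in>A. h i j) = (\<Sum>i\<in>A. \<Sum>j\<in>A. h j i)" by (rule sum.swap)
  also have "\<dots> = - (\<Sum>i\<in>A. \<Sum>j\<in>A. h i j)" by (subst assms) (simp add: sum_negf)
  finally show ?thesis by simp
qed

lemma ip_Rq_Rq:
  "ip (Rq q X ** Rq q Y) Z = (\<Sum>i\<in>UNIV. \<Sum>j\<in>UNIV. \<Sum>k\<in>UNIV.
     coth_diff q i j * coth_diff q j k * Re (X $ i $ j * Y $ j $ k * Z $ k $ i))"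
  unfolding ip_triple Rq_nth by (intro sum.cong refl) (simp add: algebra_simps)

text \<open>After renaming indices the three traces share the same monomials, so their coefficients
  add up to the left-hand side of \<open>coth_diff_cyclic\<close>.\<close>

lemma ip_Rq_Rq_cyclic:
  assumes "inj (($) q)"
  shows "ip (Rq q X ** Rq q Y) Z + ip (Rq q Y ** Rq q Z) X + ip (Rq q Z ** Rq q X) Y
    = - ip (X ** Y) Z
      + (\<Sum>i\<in>UNIV. \<Sum>j\<in>UNIV. (1 - (coth_diff q i j)\<^sup>2) * (Re (X $ i $ i * Y $ i $ j * Z $ j $ i)
          + Re (X $ i $ j * Y $ j $ j * Z $ j $ i) + Re (X $ i $ j * Y $ j $ i * Z $ i $ i)))
      - 2 * (\<Sum>i\<in>UNIV. Re (X $ i $ i * Y $ i $ i * Z $ i $ i))"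
proof -
  let ?c = "coth_diff q"
  let ?t = "\<lambda>i j k. Re (X $ i $ j * Y $ j $ k * Z $ k $ i)"
  have 1: "ip (Rq q Y ** Rq q Z) X = (\<Sum>i\<in>UNIV. \<Sum>j\<in>UNIV. \<Sum>k\<in>UNIV. ?c j k * ?c k i * ?t i j k)"
    unfolding ip_Rq_Rq by (subst sum_rotate3) (simp add: mult_ac)
  have 2: "ip (Rq q Z ** Rq q X) Y = (\<Sum>i\<in>UNIV. \<Sum>j\<in>UNIV. \<Sum>k\<in>UNIV. ?c k i * ?c i j * ?t i j k)"
    unfolding ip_Rq_Rq by (subst sum_rotate3, subst sum_rotate3) (simp add: mult_ac)
  have "ip (Rq q X ** Rq q Y) Z + ip (Rq q Y ** Rq q Z) X + ip (Rq q Z ** Rq q X) Y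
    = (\<Sum>i\<in>UNIV. \<Sum>j\<in>UNIV. \<Sum>k\<in>UNIV. (?c i j * ?c j k + ?c j k * ?c k i + ?c k i * ?c i j) * ?t i j k)"
    unfolding 1 2 unfolding ip_Rq_Rq by (simp only: distrib_right sum.distrib)
  also have "\<dots> = (\<Sum>i\<in>UNIV. \<Sum>j\<in>UNIV. \<Sum>k\<in>UNIV. - ?t i j k
      + (if i = j then (1 - (?c j k)\<^sup>2) * ?t i j k else 0) + (if j = k then (1 - (?c k i)\<^sup>2) * ?t i j k else 0)
      + (if k = i then (1 - (?c i j)\<^sup>2) * ?t i j k else 0) - (if i = j then if j = k then 2 * ?t i j k else 0 else 0))"
    unfolding coth_diff_cyclic[OF assms] by (intro sum.cong refl) (simp add: algebra_simps)
  also have "\<dots> = - ip (X ** Y) Z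
      + ((\<Sum>i\<in>UNIV. \<Sum>k\<in>UNIV. (1 - (?c i k)\<^sup>2) * ?t i i k) + (\<Sum>i\<in>UNIV. \<Sum>j\<in>UNIV. (1 - (?c j i)\<^sup>2) * ?t i j j)
      + (\<Sum>i\<in>UNIV. \<Sum>j\<in>UNIV. (1 - (?c i j)\<^sup>2) * ?t i j i)) - 2 * (\<Sum>i\<in>UNIV. ?t i i i)"
  proof -
    have a: "(\<Sum>j\<in>UNIV. \<Sum>k\<in>UNIV. if i = j then F j k else 0) = (\<Sum>k\<in>UNIV. F i k)"
      for i :: 'a and F :: "'a \<Rightarrow> 'a \<Rightarrow> real"
      by (subst sum.swap) (simp add: sum.delta)
    show ?thesis
      unfolding sum.distrib sum_subtractf sum_negf a ip_triple
      by (simp add: sum_distrib_left)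
  qed
  also have "(\<Sum>i\<in>UNIV. \<Sum>j\<in>UNIV. (1 - (?c j i)\<^sup>2) * ?t i j j) = (\<Sum>i\<in>UNIV. \<Sum>j\<in>UNIV. (1 - (?c i j)\<^sup>2) * ?t i j j)"
    by (subst coth_diff_swap) simp
  finally show ?thesis
    by (simp only: sum.distrib distrib_left)
qed

lemma ip_dRq:
  "ip X (dRq q \<xi> Y) = (\<Sum>i\<in>UNIV. \<Sum>j\<in>UNIV. (1 - (coth_diff q i j)\<^sup>2) * ((\<xi> $ j - \<xi> $ i) * Re (X $ i $ j * Y $ j $ i)))"
proof -
  have "Re (X $ i $ j * (Y $ j $ i * complex_of_real ((1 - (coth_diff q j i)\<^sup>2) * (\<xi> $ j - \<xi> $ i))))
    = (1 - (coth_diff q i j)\<^sup>2) * ((\<xi> $ j - \<xi> $ i) * Re (X $ i $ j * Y $ j $ i))" for i j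
  proof -
    have "Re (a * (b * complex_of_real r)) = r * Re (a * b)" for a b r by (simp add: algebra_simps)
    moreover have "(coth_diff q j i)\<^sup>2 = (coth_diff q i j)\<^sup>2" by (subst coth_diff_swap) simp
    ultimately show ?thesis by simp
  qed
  then show ?thesis unfolding ip_sum dRq_def by simp
qed

text \<open>Antisymmetrizing the cyclic identity removes the constant -1 by the hypothesis on
  traces, and the purely diagonal cubic terms cancel. The terms left by index coincidences carry the
  factor 1 - coth^2, exactly as the derivative of R(q) does.\<close>

lemma dynamical_Yang_Baxter:
  assumes "inj (($) q)"
    and real: "\<And>i. Im (P $ i $ i) = 0" "\<And>i. Im (Q $ i $ i) = 0" "\<And>i. Im (S $ i $ i) = 0"
    and tr: "ip (P ** Q) S = ip (Q ** P) S"
  shows "ip (comm (Rq q Q) (Rq q P)) S + ip (comm (Rq q S) (Rq q Q)) P + ip (comm (Rq q P) (Rq q S)) Q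
    + ip Q (dRq q (- diagvec P) S) + ip S (dRq q (- diagvec Q) P) + ip P (dRq q (- diagvec S) Q) = 0"
proof -
  let ?g = "\<lambda>i j. 1 - (coth_diff q i j)\<^sup>2"
  let ?p = "\<lambda>i. Re (P $ i $ i)" and ?q = "\<lambda>i. Re (Q $ i $ i)" and ?s = "\<lambda>i. Re (S $ i $ i)"
  let ?PQ = "\<lambda>i j. Re (P $ i $ j * Q $ j $ i)" and ?PS = "\<lambda>i j. Re (P $ i $ j * S $ j $ i)"
    and ?QS = "\<lambda>i j. Re (Q $ i $ j * S $ j $ i)"
  have swap: "Re (Q $ i $ j * P $ j $ i) = ?PQ j i" "Re (S $ i $ j * P $ j $ i) = ?PS j i" for i j
    by (simp_all add: mult.commute)
  \<comment> \<open>Reality of the diagonals is what allows a diagonal entry to be pulled out of the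
    real part.\<close>
  have re: "Re (P $ i $ i * Q $ i $ j * S $ j $ i) = ?p i * ?QS i j"
    "Re (P $ i $ j * Q $ j $ j * S $ j $ i) = ?q j * ?PS i j"
    "Re (P $ i $ j * Q $ j $ i * S $ i $ i) = ?s i * ?PQ i j"
    "Re (Q $ i $ i * P $ i $ j * S $ j $ i) = ?q i * ?PS i j"
    "Re (Q $ i $ j * P $ j $ j * S $ j $ i) = ?p j * ?QS i j"
    "Re (Q $ i $ j * P $ j $ i * S $ i $ i) = ?s i * ?PQ j i" for i j
    by (simp_all add: real algebra_simps)
  have "ip (comm (Rq q Q) (Rq q P)) S + ip (comm (Rq q S) (Rq q Q)) P + ip (comm (Rq q P) (Rq q S)) Q
    = (ip (Rq q Q ** Rq q P) S + ip (Rq q P ** Rq q S) Q + ip (Rq q S ** Rq q Q) P)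
    - (ip (Rq q P ** Rq q Q) S + ip (Rq q Q ** Rq q S) P + ip (Rq q S ** Rq q P) Q)"
    by (simp add: comm_def ip_linear)
  also have "\<dots> = (\<Sum>i\<in>UNIV. \<Sum>j\<in>UNIV. ?g i j * (?q i * ?PS i j + ?p j * ?QS i j + ?s i * ?PQ j i))
      - (\<Sum>i\<in>UNIV. \<Sum>j\<in>UNIV. ?g i j * (?p i * ?QS i j + ?q j * ?PS i j + ?s i * ?PQ i j))"
    unfolding ip_Rq_Rq_cyclic[OF assms(1)] re using tr by (simp add: real mult.commute mult.left_commute)
  finally have "ip (comm (Rq q Q) (Rq q P)) S + ip (comm (Rq q S) (Rq q Q)) P + ip (comm (Rq q P) (Rq q S)) Q
    + ip Q (dRq q (- diagvec P) S) + ip S (dRq q (- diagvec Q) P) + ip P (dRq q (- diagvec S) Q)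
    = (\<Sum>i\<in>UNIV. \<Sum>j\<in>UNIV. ?g i j * (?q i * ?PS i j + ?p j * ?QS i j + ?s i * ?PQ j i
       - (?p i * ?QS i j + ?q j * ?PS i j + ?s i * ?PQ i j)
       + (?p i - ?p j) * ?QS i j + (?q i - ?q j) * ?PS j i + (?s i - ?s j) * ?PQ i j))"
    unfolding ip_dRq swap by (simp add: diagvec_def algebra_simps sum.distrib sum_subtractf)
  also have "\<dots> = 0"
  \<comment> \<open>The summand need not vanish entrywise; it changes sign under exchange of i and
    j, because the factor 1 - coth^2 is even.\<close>
  proof (rule sum_antisym_zero)
    fix i j
    have "?g j i = ?g i j" by (subst coth_diff_swap) simp
    then show "?g j i * (?q j * ?PS j i + ?p i * ?QS j i + ?s j * ?PQ i j
       - (?p j * ?QS j i + ?q i * ?PS j i + ?s j * ?PQ j i)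
       + (?p j - ?p i) * ?QS j i + (?q j - ?q i) * ?PS i j + (?s j - ?s i) * ?PQ j i)
      = - (?g i j * (?q i * ?PS i j + ?p j * ?QS i j + ?s i * ?PQ j i
       - (?p i * ?QS i j + ?q j * ?PS i j + ?s i * ?PQ i j)
       + (?p i - ?p j) * ?QS i j + (?q i - ?q j) * ?PS j i + (?s i - ?s j) * ?PQ i j))"
      by (simp add: algebra_simps del: times_complex.sel)
  qed
  finally show ?thesis .
qed

section \<open>Diagonal matrices and their pairing with R(q)\<close>

definition diag_mat :: "real^'n \<Rightarrow> 'n::finite mat" where
  "diag_mat a = (\<chi> i j. if i = j then complex_of_real (a $ i) else 0)"

lemma diag_mat_linear: "diag_mat (a + b) = diag_mat a + diag_mat b" "diag_mat (c *\<^sub>R a) = c *\<^sub>R diag_mat a"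
  by (simp_all add: vec_eq_iff diag_mat_def scaleR_conv_of_real[where 'a = complex])

lemma adj_diag_mat: "adj (diag_mat a) = diag_mat a"
  by (simp add: vec_eq_iff diag_mat_def adj_def)

lemma diag_mat_mult_nth: "(diag_mat a ** X) $ i $ j = complex_of_real (a $ i) * X $ i $ j"
  by (simp add: diag_mat_def matrix_matrix_mult_def if_distrib[of "\<lambda>x. x * _"] cong: if_cong)

lemma ip_diag_mat: "ip (diag_mat a) X = (\<Sum>i\<in>UNIV. a $ i * Re (X $ i $ i))"
  unfolding ip_def mtrace_def diag_mat_mult_nth by simp

lemma ip_diag_mat_inner: "ip (diag_mat a) X = a \<bullet> diagvec X"
  by (simp add: ip_diag_mat inner_vec_def diagvec_def)

lemma diag_mat_commute: "diag_mat a ** diag_mat b = diag_mat b ** diag_mat a"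
  unfolding vec_eq_iff diag_mat_mult_nth by (simp add: diag_mat_def)

lemma ip_rotate4: "ip (A ** B) (C ** D) = ip (B ** C) (D ** A)"
  for A B C D :: "'n::finite mat"
  unfolding ip_assoc[of A] matrix_mul_assoc by (rule ip_rotate)

lemma comm_linear:
  "comm (X + Y) Z = comm X Z + comm Y Z" "comm Z (X + Y) = comm Z X + comm Z Y"
  "comm (X - Y) Z = comm X Z - comm Y Z" "comm Z (X - Y) = comm Z X - comm Z Y"
  "comm (c *\<^sub>R X) Z = c *\<^sub>R comm X Z" "comm Z (c *\<^sub>R X) = c *\<^sub>R comm Z X"
  by (simp_all add: comm_def matrix_ring algebra_simps)

text \<open>Since coth is odd, (R X) Y + X (R Y) has zero diagonal and is invisible to diagonal
  matrices. This removes the terms of the Schouten bracket that are linear in a base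
  component.\<close>

lemma diag_comm_Rq: "ip (comm (diag_mat a) (Rq q X)) Y + ip (comm (Rq q Y) (diag_mat a)) X = 0"
proof -
  have diag: "ip (diag_mat a) (Rq q X ** Y) + ip (diag_mat a) (X ** Rq q Y) = 0" for X Y
  proof -
    have "(Rq q X ** Y) $ i $ i + (X ** Rq q Y) $ i $ i = 0" for i
    proof -
      have "Rq q X $ i $ k * Y $ k $ i + X $ i $ k * Rq q Y $ k $ i = 0" for k
        unfolding Rq_nth by (subst coth_diff_swap[of q k i]) simp
      then show ?thesis by (simp add: matrix_matrix_mult_def flip: sum.distrib)
    qed
    then have "a $ i * Re ((Rq q X ** Y) $ i $ i) + a $ i * Re ((X ** Rq q Y) $ i $ i) = 0" for i
      by (metis distrib_left mult_zero_right plus_complex.sel(1) zero_complex.sel(1))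
    then show ?thesis unfolding ip_diag_mat by (simp flip: sum.distrib)
  qed
  have "ip (comm (diag_mat a) (Rq q X)) Y = ip (diag_mat a) (Rq q X ** Y) - ip (diag_mat a) (Y ** Rq q X)"
    by (simp add: comm_def ip_linear ip_assoc) (metis ip_rotate)
  moreover have "ip (comm (Rq q Y) (diag_mat a)) X = ip (diag_mat a) (X ** Rq q Y) - ip (diag_mat a) (Rq q Y ** X)"
    by (simp add: comm_def ip_linear ip_assoc) (metis ip_rotate)
  ultimately show ?thesis using diag[of X Y] diag[of Y X] by simp
qed

subsection \<open>The two bivectors\<close>

text \<open>A covector at \<open>(q, J)\<close> is a pair \<open>(a, A)\<close> of partial gradients. For Hermitian \<open>A\<close> the first bivector
  agrees with the formula of the theorem; the present form is the coefficient of \<open>\<epsilon>\<close> in the second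
  bivector at \<open>J + \<epsilon> 1\<close>.\<close>

definition biv1 :: "'n::finite pt \<Rightarrow> 'n pt \<Rightarrow> 'n pt \<Rightarrow> real" where
  "biv1 x \<alpha> \<beta> = ip (diag_mat (fst \<alpha>)) (snd \<beta>) - ip (diag_mat (fst \<beta>)) (snd \<alpha>)
    + 2 * (ip (snd x ** snd \<alpha>) (Rq (fst x) (snd \<beta>)) + ip (snd \<alpha>) (Rq (fst x) (snd x ** snd \<beta>)))"

definition biv2 :: "'n::finite pt \<Rightarrow> 'n pt \<Rightarrow> 'n pt \<Rightarrow> real" where
  "biv2 x \<alpha> \<beta> = ip (diag_mat (fst \<alpha>)) (snd x ** snd \<beta>) - ip (diag_mat (fst \<beta>)) (snd x ** snd \<alpha>)
    + 2 * ip (snd x ** snd \<alpha>) (Rq (fst x) (snd x ** snd \<beta>))"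

definition dbiv1 :: "'n::finite pt \<Rightarrow> 'n pt \<Rightarrow> 'n pt \<Rightarrow> 'n pt \<Rightarrow> real" where
  "dbiv1 x v \<alpha> \<beta> = 2 * (ip (snd v ** snd \<alpha>) (Rq (fst x) (snd \<beta>)) + ip (snd x ** snd \<alpha>) (dRq (fst x) (fst v) (snd \<beta>))
    + ip (snd \<alpha>) (Rq (fst x) (snd v ** snd \<beta>)) + ip (snd \<alpha>) (dRq (fst x) (fst v) (snd x ** snd \<beta>)))"

definition dbiv2 :: "'n::finite pt \<Rightarrow> 'n pt \<Rightarrow> 'n pt \<Rightarrow> 'n pt \<Rightarrow> real" where
  "dbiv2 x v \<alpha> \<beta> = ip (diag_mat (fst \<alpha>)) (snd v ** snd \<beta>) - ip (diag_mat (fst \<beta>)) (snd v ** snd \<alpha>)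
    + 2 * (ip (snd v ** snd \<alpha>) (Rq (fst x) (snd x ** snd \<beta>)) + ip (snd x ** snd \<alpha>) (Rq (fst x) (snd v ** snd \<beta>))
      + ip (snd x ** snd \<alpha>) (dRq (fst x) (fst v) (snd x ** snd \<beta>)))"

text \<open>Found by solving
  \<open>ham1 x \<alpha> \<bullet> \<beta> = biv1 x \<alpha> \<beta>\<close> for Hermitian
  \<open>snd \<beta>\<close>: cyclicity of the trace isolates \<open>snd \<beta>\<close>, and
  \<open>mminus\<close> discards the part that such covectors do not see. \<open>ham2\<close> arises
  in the same way.\<close>

definition ham1 :: "'n::finite pt \<Rightarrow> 'n pt \<Rightarrow> 'n pt" where
  "ham1 x \<alpha> = (- diagvec (snd \<alpha>), mminus (diag_mat (fst \<alpha>) - 2 *\<^sub>R Rq (fst x) (snd x ** snd \<alpha>)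
    - 2 *\<^sub>R (Rq (fst x) (snd \<alpha>) ** snd x)))"

definition ham2 :: "'n::finite pt \<Rightarrow> 'n pt \<Rightarrow> 'n pt" where
  "ham2 x \<alpha> = (- diagvec (snd x ** snd \<alpha>),
    mminus ((diag_mat (fst \<alpha>) - 2 *\<^sub>R Rq (fst x) (snd x ** snd \<alpha>)) ** snd x))"

lemma diagvec_linear: "diagvec (X + Y) = diagvec X + diagvec Y" "diagvec (c *\<^sub>R X) = c *\<^sub>R diagvec X"
  by (simp_all add: diagvec_def vec_eq_iff)

lemma mminus_linear: "mminus (X + Y) = mminus X + mminus Y" "mminus (c *\<^sub>R X) = c *\<^sub>R mminus X"
  by (simp_all add: mminus_def adj_add adj_scaleR algebra_simps)

lemma biv_antisym: "biv1 x \<alpha> \<beta> = - biv1 x \<beta> \<alpha>" "biv2 x \<alpha> \<beta> = - biv2 x \<beta> \<alpha>"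
proof -
  have "ip X (Rq (fst x) Y) = - ip Y (Rq (fst x) X)" for X Y
    by (simp only: ip_Rq[of X] ip_commute[of Y])
  from this[of "snd x ** snd \<alpha>" "snd \<beta>"] this[of "snd \<alpha>" "snd x ** snd \<beta>"]
    this[of "snd x ** snd \<alpha>" "snd x ** snd \<beta>"]
  show "biv1 x \<alpha> \<beta> = - biv1 x \<beta> \<alpha>" "biv2 x \<alpha> \<beta> = - biv2 x \<beta> \<alpha>"
    unfolding biv1_def biv2_def by simp_all
qed

lemma biv_bilinear: "bilinear (biv1 x)" "bilinear (biv2 x)" "bilinear (dbiv1 x v)" "bilinear (dbiv2 x v)"
  unfolding bilinear_def biv1_def biv2_def dbiv1_def dbiv2_def
  by (safe; rule linearI; simp add: diag_mat_linear matrix_ring Rq_linear dRq_linear ip_linear algebra_simps)+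

lemma dbiv_linear:
  "dbiv1 x (v + w) \<alpha> \<beta> = dbiv1 x v \<alpha> \<beta> + dbiv1 x w \<alpha> \<beta>" "dbiv1 x (c *\<^sub>R v) \<alpha> \<beta> = c * dbiv1 x v \<alpha> \<beta>"
  "dbiv2 x (v + w) \<alpha> \<beta> = dbiv2 x v \<alpha> \<beta> + dbiv2 x w \<alpha> \<beta>" "dbiv2 x (c *\<^sub>R v) \<alpha> \<beta> = c * dbiv2 x v \<alpha> \<beta>"
  unfolding dbiv1_def dbiv2_def
  by (simp_all add: matrix_ring Rq_linear dRq_linear ip_linear algebra_simps)

text \<open>Bridge between the Euclidean inner product, in which gradients live, and the trace form,
  in which \<open>d2\<close> and \<open>d2m\<close> are defined; they agree when X is
  Hermitian.\<close>

lemma inner_mat: "X \<bullet> Y = ip (adj X) Y" for X Y :: "'n::finite mat"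
proof -
  have "ip (adj X) Y = (\<Sum>i\<in>UNIV. \<Sum>j\<in>UNIV. X $ j $ i \<bullet> Y $ j $ i)"
    by (simp add: ip_sum adj_def inner_complex_def)
  also have "\<dots> = X \<bullet> Y" unfolding inner_vec_def by (rule sum.swap)
  finally show ?thesis ..
qed

lemma inner_mat_herm: "adj X = X \<Longrightarrow> X \<bullet> Y = ip X Y" for X Y :: "'n::finite mat"
  by (simp add: inner_mat)

lemma inner_ham:
  assumes "adj (snd \<beta>) = snd \<beta>"
  shows "ham1 x \<alpha> \<bullet> \<beta> = biv1 x \<alpha> \<beta>" "ham2 x \<alpha> \<bullet> \<beta> = biv2 x \<alpha> \<beta>"
proof -
  let ?J = "snd x" and ?A = "snd \<alpha>" and ?B = "snd \<beta>" and ?R = "Rq (fst x)"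
  have R: "ip (?J ** ?A) (?R ?B) = - ip (?R (?J ** ?A)) ?B"
    "ip (?J ** ?A) (?R (?J ** ?B)) = - ip (?R (?J ** ?A) ** ?J) ?B"
    "ip ?A (?R (?J ** ?B)) = - ip (?R ?A ** ?J) ?B"
    by (simp_all add: ip_Rq ip_assoc)
  have "ham1 x \<alpha> \<bullet> \<beta> = - (diagvec ?A \<bullet> fst \<beta>) + ip (diag_mat (fst \<alpha>) - 2 *\<^sub>R ?R (?J ** ?A) - 2 *\<^sub>R (?R ?A ** ?J)) ?B"
    unfolding inner_prod_def ham1_def
    by (simp only: fst_conv snd_conv inner_mat_herm[OF adj_mminus] ip_mminus_herm[OF assms] inner_minus_left)
  then show "ham1 x \<alpha> \<bullet> \<beta> = biv1 x \<alpha> \<beta>"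
    by (simp add: biv1_def R ip_linear ip_diag_mat_inner inner_commute algebra_simps)
  have "ham2 x \<alpha> \<bullet> \<beta> = - (diagvec (?J ** ?A) \<bullet> fst \<beta>) + ip ((diag_mat (fst \<alpha>) - 2 *\<^sub>R ?R (?J ** ?A)) ** ?J) ?B"
    unfolding inner_prod_def ham2_def
    by (simp only: fst_conv snd_conv inner_mat_herm[OF adj_mminus] ip_mminus_herm[OF assms] inner_minus_left)
  then show "ham2 x \<alpha> \<bullet> \<beta> = biv2 x \<alpha> \<beta>"
    unfolding biv2_def R by (simp add: ip_linear ip_assoc matrix_ring ip_diag_mat_inner inner_commute algebra_simps)
qed

text \<open>With the abbreviations \<open>P = J A\<close> and \<open>W = a - 2 R P\<close> attached to a covector \<open>(a, A)\<close>, the cyclic sum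
  splits into \<open>\<langle>[W', W], J A''\<rangle>\<close>, controlled by the dynamical Yang-Baxter equation, and terms
  \<open>Re tr (J W\<^sup>* A'' W')\<close>, which are symmetric in \<open>W\<close>, \<open>W'\<close> and hence cancel.\<close>

lemma schouten_biv2:
  assumes q: "inj (($) (fst x))" and J: "adj (snd x) = snd x"
    and herm: "adj (snd \<alpha>) = snd \<alpha>" "adj (snd \<beta>) = snd \<beta>" "adj (snd \<gamma>) = snd \<gamma>"
    and real: "\<And>i. Im ((snd x ** snd \<alpha>) $ i $ i) = 0" "\<And>i. Im ((snd x ** snd \<beta>) $ i $ i) = 0"
      "\<And>i. Im ((snd x ** snd \<gamma>) $ i $ i) = 0"
  shows "dbiv2 x (ham2 x \<alpha>) \<beta> \<gamma> + dbiv2 x (ham2 x \<beta>) \<gamma> \<alpha> + dbiv2 x (ham2 x \<gamma>) \<alpha> \<beta> = 0"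
proof -
  let ?J = "snd x" and ?R = "Rq (fst x)"
  let ?P = "\<lambda>\<alpha>. ?J ** snd \<alpha>"
  let ?W = "\<lambda>\<alpha>. diag_mat (fst \<alpha>) - 2 *\<^sub>R ?R (?P \<alpha>)"
  let ?u = "\<lambda>\<alpha> \<beta> \<gamma>. ip (?J ** adj (?W \<alpha>)) (snd \<gamma> ** ?W \<beta>)"
  have d: "dbiv2 x (ham2 x \<alpha>) \<beta> \<gamma> = (ip (?W \<beta> ** ?W \<alpha>) (?P \<gamma>) - ip (?W \<gamma> ** ?W \<alpha>) (?P \<beta>)
      + ?u \<alpha> \<beta> \<gamma> - ?u \<alpha> \<gamma> \<beta>) / 2 + 2 * ip (?P \<beta>) (dRq (fst x) (- diagvec (?P \<alpha>)) (?P \<gamma>))" for \<alpha> \<beta> \<gamma>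
  proof -
    let ?V = "snd (ham2 x \<alpha>)"
    have 1: "dbiv2 x (ham2 x \<alpha>) \<beta> \<gamma> = ip ?V (snd \<gamma> ** ?W \<beta>) - ip ?V (snd \<beta> ** ?W \<gamma>)
      + 2 * ip (?P \<beta>) (dRq (fst x) (fst (ham2 x \<alpha>)) (?P \<gamma>))"
    proof -
      have "ip (?P \<beta>) (?R (?V ** snd \<gamma>)) = - ip ?V (snd \<gamma> ** ?R (?P \<beta>))"
        by (simp only: ip_Rq ip_rotate[of "?R _"])
      then show ?thesis
        unfolding dbiv2_def ip_rotate[of "diag_mat _"] ip_assoc[of ?V]
        by (simp add: matrix_ring ip_linear algebra_simps)
    qed
    \<comment> \<open>The Hermitian projection in \<open>ham2\<close> is the mean of W J and its
      adjoint J W^*; the first half feeds the Yang-Baxter part, the second the symmetric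
      part.\<close>
    have 2: "ip ?V (snd \<gamma> ** ?W \<beta>) = (ip (?W \<beta> ** ?W \<alpha>) (?P \<gamma>) + ?u \<alpha> \<beta> \<gamma>) / 2" for \<beta> \<gamma>
    proof -
      have "ip (?W \<alpha> ** ?J) (snd \<gamma> ** ?W \<beta>) = ip (?W \<beta> ** ?W \<alpha>) (?P \<gamma>)"
        by (subst ip_rotate4) (rule ip_commute)
      then show ?thesis
        unfolding ham2_def snd_conv ip_mminus adj_mult J by simp
    qed
    show ?thesis unfolding 1 2 by (simp add: ham2_def add_divide_distrib diff_divide_distrib)
  qed
  have u: "?u \<alpha> \<beta> \<gamma> = ?u \<beta> \<alpha> \<gamma>" if "adj (snd \<gamma>) = snd \<gamma>" for \<alpha> \<beta> \<gamma>
  proof -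
    have "?u \<alpha> \<beta> \<gamma> = ip (adj (?J ** adj (?W \<alpha>))) (adj (snd \<gamma> ** ?W \<beta>))" by (rule ip_adj[symmetric])
    also have "\<dots> = ip (?W \<alpha> ** ?J) (adj (?W \<beta>) ** snd \<gamma>)" by (simp add: adj_mult J that)
    also have "\<dots> = ?u \<beta> \<alpha> \<gamma>" by (rule ip_rotate4)
    finally show ?thesis .
  qed
  have W: "ip (?W \<beta> ** ?W \<alpha>) Z - ip (?W \<alpha> ** ?W \<beta>) Z
      = - 2 * ip (comm (diag_mat (fst \<beta>)) (?R (?P \<alpha>))) Z - 2 * ip (comm (?R (?P \<beta>)) (diag_mat (fst \<alpha>))) Z
        + 4 * ip (comm (?R (?P \<beta>)) (?R (?P \<alpha>))) Z" for \<alpha> \<beta> Z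
  proof -
    have "ip (?W \<beta> ** ?W \<alpha>) Z - ip (?W \<alpha> ** ?W \<beta>) Z = ip (comm (?W \<beta>) (?W \<alpha>)) Z"
      by (simp add: comm_def ip_linear)
    moreover have "comm (diag_mat (fst \<beta>)) (diag_mat (fst \<alpha>)) = 0"
      unfolding comm_def by (subst diag_mat_commute) simp
    ultimately show ?thesis by (simp add: comm_linear ip_linear)
  qed
  \<comment> \<open>Taking adjoints reverses the word J A J A' J A'', and cyclicity brings the
    reversed word to the one with the first two factors exchanged.\<close>
  have tr: "ip (?P \<alpha> ** ?P \<beta>) (?P \<gamma>) = ip (?P \<beta> ** ?P \<alpha>) (?P \<gamma>)"
  proof -
    have "ip (?P \<alpha> ** ?P \<beta>) (?P \<gamma>) = ip (adj (?P \<alpha> ** ?P \<beta>)) (adj (?P \<gamma>))" by (rule ip_adj[symmetric])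
    also have "\<dots> = ip (snd \<beta> ** ?J ** (snd \<alpha> ** ?J)) (snd \<gamma> ** ?J)"
      by (simp add: adj_mult J herm)
    also have "\<dots> = ip (?P \<beta> ** ?P \<alpha>) (?P \<gamma>)"
      by (subst ip_rotate, subst ip_rotate) (simp only: ip_assoc matrix_mul_assoc[symmetric])
    finally show ?thesis .
  qed
  have "dbiv2 x (ham2 x \<alpha>) \<beta> \<gamma> + dbiv2 x (ham2 x \<beta>) \<gamma> \<alpha> + dbiv2 x (ham2 x \<gamma>) \<alpha> \<beta>
    = ((ip (?W \<beta> ** ?W \<alpha>) (?P \<gamma>) - ip (?W \<alpha> ** ?W \<beta>) (?P \<gamma>))
      + (ip (?W \<gamma> ** ?W \<beta>) (?P \<alpha>) - ip (?W \<beta> ** ?W \<gamma>) (?P \<alpha>))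
      + (ip (?W \<alpha> ** ?W \<gamma>) (?P \<beta>) - ip (?W \<gamma> ** ?W \<alpha>) (?P \<beta>))) / 2
     + 2 * (ip (?P \<beta>) (dRq (fst x) (- diagvec (?P \<alpha>)) (?P \<gamma>)) + ip (?P \<gamma>) (dRq (fst x) (- diagvec (?P \<beta>)) (?P \<alpha>))
       + ip (?P \<alpha>) (dRq (fst x) (- diagvec (?P \<gamma>)) (?P \<beta>)))"
    unfolding d using u[OF herm(1), of \<beta> \<gamma>] u[OF herm(2), of \<alpha> \<gamma>] u[OF herm(3), of \<alpha> \<beta>]
    by (simp add: field_simps)
  \<comment> \<open>The commutators quadratic in R combine with the derivatives of R into the
    Yang-Baxter equation; the mixed commutators with a diagonal matrix cancel in pairs, one pair for
    each base component.\<close>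
  also have "\<dots> = 0"
    unfolding W
    using dynamical_Yang_Baxter[OF q real tr]
      diag_comm_Rq[of "fst \<alpha>" "fst x" "?P \<gamma>" "?P \<beta>"] diag_comm_Rq[of "fst \<beta>" "fst x" "?P \<alpha>" "?P \<gamma>"]
      diag_comm_Rq[of "fst \<gamma>" "fst x" "?P \<beta>" "?P \<alpha>"]
    by (simp add: field_simps)
  finally show ?thesis .
qed

section \<open>The pencil of both bivectors, by shifting J\<close>

definition shift :: "real \<Rightarrow> 'n::finite pt \<Rightarrow> 'n pt" where
  "shift e x = (fst x, snd x + e *\<^sub>R mat 1)"

text \<open>The e^2 term pairs a Hermitian matrix with the derivative of R at a Hermitian matrix,
  which is anti-Hermitian.\<close>

lemma dbiv2_shift:
  assumes "adj (snd \<alpha>) = snd \<alpha>" "adj (snd \<beta>) = snd \<beta>"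
  shows "dbiv2 (shift e x) v \<alpha> \<beta> = dbiv2 x v \<alpha> \<beta> + e * dbiv1 x v \<alpha> \<beta>"
  unfolding dbiv2_def dbiv1_def shift_def
  by (simp add: matrix_ring Rq_linear dRq_linear ip_linear ip_dRq_herm[OF assms] algebra_simps)

text \<open>Here the e^2 term is a multiple of R A, which the Hermitian projection kills.\<close>

lemma ham2_shift:
  assumes "adj (snd \<alpha>) = snd \<alpha>"
  shows "ham2 (shift e x) \<alpha> = ham2 x \<alpha> + e *\<^sub>R ham1 x \<alpha>"
proof -
  have z: "mminus (Rq (fst x) (snd \<alpha>)) = 0"
    by (simp add: mminus_def adj_Rq assms)
  have "(diag_mat (fst \<alpha>) - 2 *\<^sub>R Rq (fst x) ((snd x + e *\<^sub>R mat 1) ** snd \<alpha>)) ** (snd x + e *\<^sub>R mat 1)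
    = (diag_mat (fst \<alpha>) - 2 *\<^sub>R Rq (fst x) (snd x ** snd \<alpha>)) ** snd x
     + e *\<^sub>R (diag_mat (fst \<alpha>) - 2 *\<^sub>R Rq (fst x) (snd x ** snd \<alpha>) - 2 *\<^sub>R (Rq (fst x) (snd \<alpha>) ** snd x))
     + (- 2 * e * e) *\<^sub>R Rq (fst x) (snd \<alpha>)"
    by (simp add: matrix_ring Rq_linear algebra_simps)
  then show ?thesis
    unfolding ham2_def ham1_def shift_def fst_conv snd_conv
    by (simp only: mminus_linear z) (simp add: matrix_ring diagvec_linear)
qed

lemma schouten_pencil:
  assumes q: "inj (($) (fst x))" and J: "adj (snd x) = snd x"
    and herm: "adj (snd \<alpha>) = snd \<alpha>" "adj (snd \<beta>) = snd \<beta>" "adj (snd \<gamma>) = snd \<gamma>"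
    and real: "\<And>i. Im ((snd x ** snd \<alpha>) $ i $ i) = 0" "\<And>i. Im ((snd x ** snd \<beta>) $ i $ i) = 0"
      "\<And>i. Im ((snd x ** snd \<gamma>) $ i $ i) = 0"
  defines "d \<equiv> \<lambda>s t v \<alpha> \<beta>. s * dbiv1 x v \<alpha> \<beta> + t * dbiv2 x v \<alpha> \<beta>"
    and "X \<equiv> \<lambda>s t \<alpha>. s *\<^sub>R ham1 x \<alpha> + t *\<^sub>R ham2 x \<alpha>"
  shows "d s t (X s t \<alpha>) \<beta> \<gamma> + d s t (X s t \<beta>) \<gamma> \<alpha> + d s t (X s t \<gamma>) \<alpha> \<beta> = 0"
proof -
  let ?T = "\<lambda>D X. D x (X x \<alpha>) \<beta> \<gamma> + D x (X x \<beta>) \<gamma> \<alpha> + D x (X x \<gamma>) \<alpha> \<beta>"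
  have exp: "d s t (X s t \<alpha>) \<beta> \<gamma> + d s t (X s t \<beta>) \<gamma> \<alpha> + d s t (X s t \<gamma>) \<alpha> \<beta>
    = s * s * ?T dbiv1 ham1 + s * t * (?T dbiv1 ham2 + ?T dbiv2 ham1) + t * t * ?T dbiv2 ham2" for s t
    unfolding d_def X_def dbiv_linear by (simp add: algebra_simps)
  have zero: "d e 1 (X e 1 \<alpha>) \<beta> \<gamma> + d e 1 (X e 1 \<beta>) \<gamma> \<alpha> + d e 1 (X e 1 \<gamma>) \<alpha> \<beta> = 0" for e
  proof -
    \<comment> \<open>The shift adds e A to J A, and the diagonal of a Hermitian A is real.\<close>
    have diag: "Im ((snd (shift e x) ** snd \<alpha>) $ i $ i) = 0"
      if h: "adj (snd \<alpha>) = snd \<alpha>" and r: "\<And>i. Im ((snd x ** snd \<alpha>) $ i $ i) = 0" for \<alpha> i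
    proof -
      have "cnj (snd \<alpha> $ i $ i) = snd \<alpha> $ i $ i"
        using arg_cong[OF h, of "\<lambda>X. X $ i $ i"] by (simp add: adj_def)
      then have "Im (snd \<alpha> $ i $ i) = 0" by (simp add: complex_eq_iff)
      then show ?thesis using r[of i] by (simp add: shift_def matrix_ring)
    qed
    have "adj (mat 1 :: 'a mat) = mat 1" by (auto simp: adj_def mat_def vec_eq_iff)
    then have "adj (snd (shift e x)) = snd (shift e x)" by (simp add: shift_def adj_add adj_scaleR J)
    moreover have "inj (($) (fst (shift e x)))" using q by (simp add: shift_def)
    ultimately have "dbiv2 (shift e x) (ham2 (shift e x) \<alpha>) \<beta> \<gamma> + dbiv2 (shift e x) (ham2 (shift e x) \<beta>) \<gamma> \<alpha>
      + dbiv2 (shift e x) (ham2 (shift e x) \<gamma>) \<alpha> \<beta> = 0"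
      by (intro schouten_biv2 diag herm real)
    then show ?thesis
      unfolding d_def X_def
      by (simp add: dbiv2_shift herm ham2_shift) (simp add: add.commute)
  qed
  \<comment> \<open>A quadratic polynomial in e with zeros at 0, 1 and -1 has vanishing
    coefficients.\<close>
  have "?T dbiv2 ham2 = 0" "?T dbiv1 ham1 = 0" "?T dbiv1 ham2 + ?T dbiv2 ham1 = 0"
    using zero[of 0] zero[of 1] zero[of "-1"] unfolding exp by simp_all
  then show ?thesis unfolding exp by simp
qed

subsection \<open>Restriction of the brackets to Hermitian matrices\<close>

text \<open>Commutation with a Hermitian J exchanges Hermitian and anti-Hermitian parts, so only the
  Hermitian part of the derivative survives. This is one source of independence of the
  extension.\<close>

lemma mplus_comm:
  assumes "adj J = J"
  shows "mplus (comm D J) = comm (mminus D) J"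
proof -
  have "mplus (comm D J) = (1/2) *\<^sub>R (comm D J + comm (adj D) J)"
    by (simp add: mplus_def comm_def adj_diff adj_mult assms)
  also have "\<dots> = comm (mminus D) J" by (simp add: mminus_def comm_linear)
  finally show ?thesis .
qed

lemma ip_Rq_comm:
  "ip (Rq q (comm A J)) B - ip (Rq q (comm B J)) A = ip J (comm (Rq q A) B + comm A (Rq q B))"
proof -
  have *: "ip (Rq q (comm A J)) B = ip J (comm A (Rq q B))" for A B
  proof -
    have "ip (Rq q (comm A J)) B = - ip (comm A J) (Rq q B)" by (simp add: ip_Rq)
    also have "\<dots> = ip (J ** A) (Rq q B) - ip (A ** J) (Rq q B)" by (simp add: comm_def ip_linear)
    also have "\<dots> = ip J (A ** Rq q B) - ip J (Rq q B ** A)"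
      by (simp only: ip_assoc ip_rotate[of A])
    finally show ?thesis by (simp add: comm_def ip_linear)
  qed
  show ?thesis unfolding * ip_linear by (simp add: comm_def ip_linear)
qed

text \<open>R B is anti-Hermitian, so taking adjoints reverses the trace of J A (R B) with a sign;
  each trace is therefore half of a commutator expression.\<close>

lemma biv1_herm:
  assumes "adj J = J" "adj A = A" "adj B = B"
  shows "biv1 (q, J) (a, A) (b, B) = ip (diag_mat a) B - ip (diag_mat b) A
    + ip J (comm (Rq q A) B + comm A (Rq q B))"
proof -
  have *: "2 * ip (J ** A) (Rq q B) = ip J (comm A (Rq q B))" if "adj A = A" "adj B = B" for A B
  proof -
    have "ip (J ** A) (Rq q B) = ip (adj (J ** A)) (adj (Rq q B))" by (rule ip_adj[symmetric])
    also have "\<dots> = - ip (A ** J) (Rq q B)" by (simp add: adj_mult adj_Rq that assms ip_linear)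
    also have "\<dots> = - ip J (Rq q B ** A)" by (simp only: ip_assoc ip_rotate[of A])
    finally show ?thesis by (simp add: comm_def ip_linear ip_assoc)
  qed
  have "ip A (Rq q (J ** B)) = - ip (J ** B) (Rq q A)" by (simp only: ip_Rq[of A] ip_commute[of "J ** B"])
  then show ?thesis
    using *[OF assms(2,3)] *[OF assms(3,2)]
    by (simp add: biv1_def ip_linear) (simp add: comm_def ip_linear)
qed

lemma red1_restrict:
  assumes J: "adj J = J"
  shows "ip (Rq q (mplus (comm D J))) (mminus E) - ip (Rq q (mplus (comm E J))) (mminus D)
    = ip J (comm (Rq q (mminus D)) (mminus E) + comm (mminus D) (Rq q (mminus E)))"
  unfolding mplus_comm[OF J] ip_Rq_comm ..

lemma mminus_anticomm:
  assumes J: "adj J = J"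
  shows "mminus (J ** D + D ** J) = J ** mminus D + mminus D ** J"
  by (simp add: mminus_def adj_add adj_mult J matrix_ring algebra_simps)

text \<open>With A J = (J A)^* everything becomes a pairing among J A, J B and their adjoints
  through the skew map R. The pairings with exactly one adjoint cancel, and the others add up to
  four equal terms.\<close>

lemma red2_restrict_Rq:
  assumes J: "adj J = J" and herm: "adj A = A" "adj B = B"
  shows "ip (Rq q (comm A J)) (J ** B + B ** J) - ip (Rq q (comm B J)) (J ** A + A ** J)
    = 4 * ip (J ** A) (Rq q (J ** B))"
proof -
  let ?P = "J ** A" and ?S = "J ** B"
  have adj: "A ** J = adj ?P" "B ** J = adj ?S" by (simp_all add: adj_mult J herm)
  have sw: "ip (Rq q X) Y = - ip X (Rq q Y)" for X Y by (simp add: ip_Rq)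
  have sw2: "ip X (Rq q Y) = - ip Y (Rq q X)" for X Y by (simp only: ip_Rq[of X] ip_commute[of Y])
  have aa: "ip (adj X) (Rq q (adj Y)) = - ip X (Rq q Y)" for X Y
    using ip_adj[of X "Rq q Y"] by (simp add: adj_Rq ip_linear)
  have a1: "ip X (Rq q (adj Y)) = - ip (adj X) (Rq q Y)" for X Y
    using aa[of "adj X" Y] by simp
  show ?thesis
    unfolding comm_def adj Rq_linear sw ip_linear aa a1
    using sw2[of ?S ?P] sw2[of "adj ?S" ?P] sw2[of "adj ?P" ?S] a1[of ?S ?P] a1[of ?P ?S] by simp
qed

text \<open>Holds for arbitrary D and E, so anti-Hermitian parts of the derivatives drop out here
  too. Traces without adjoints cancel in pairs, and those with one adjoint agree by cyclicity
  because J is Hermitian.\<close>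

lemma red2_restrict_remainder:
  assumes J: "adj J = J"
  shows "ip (mminus (J ** D)) (mminus (E ** J)) + ip (mplus (D ** J)) (mplus (J ** E))
    - ip (mminus (D ** J)) (mminus (J ** E)) - ip (mplus (J ** D)) (mplus (E ** J)) = 0"
proof -
  have half: "4 * ip (mminus X) (mminus Y) = 2 * ip X Y + 2 * ip (adj X) Y"
    "4 * ip (mplus X) (mplus Y) = 2 * ip X Y - 2 * ip (adj X) Y" for X Y
    using ip_adj[of X Y] by (simp_all add: mminus_def mplus_def ip_linear ip_adj_left field_simps)
  have 2: "ip (adj (J ** D)) (E ** J) = ip (adj (D ** J)) (J ** E)"
    unfolding adj_mult J by (subst ip_rotate4) (rule ip_commute)
  have "4 * (ip (mminus (J ** D)) (mminus (E ** J)) + ip (mplus (D ** J)) (mplus (J ** E))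
    - ip (mminus (D ** J)) (mminus (J ** E)) - ip (mplus (J ** D)) (mplus (E ** J))) =
    4 * ip (adj (J ** D)) (E ** J) - 4 * ip (adj (D ** J)) (J ** E)"
    using half(1)[of "J ** D" "E ** J"] half(1)[of "D ** J" "J ** E"] half(2)[of "J ** D" "E ** J"]
      half(2)[of "D ** J" "J ** E"] by (simp add: algebra_simps)
  then show ?thesis unfolding 2 by simp
qed

subsection \<open>The phase space\<close>

definition proj_herm :: "'n::finite pt \<Rightarrow> 'n pt" where
  "proj_herm x = (fst x, mminus (snd x))"

lemma M0minus_iff: "x \<in> M0minus \<longleftrightarrow> x \<in> M0reg \<and> adj (snd x) = snd x"
  by (cases x) (simp add: M0minus_def mplus_eq_0_iff)

lemma Vminus_iff: "v \<in> Vminus \<longleftrightarrow> adj (snd v) = snd v"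
  by (cases v) (simp add: Vminus_def herm_def)

lemma M0reg_iff: "x \<in> M0reg \<longleftrightarrow> (\<forall>i j. i < j \<longrightarrow> fst x $ j < fst x $ i)"
  by (cases x) (simp add: M0reg_def)

lemma M0reg_inj: "x \<in> M0reg \<Longrightarrow> inj (($) (fst x))"
  unfolding M0reg_iff by (rule injI) (metis less_irrefl linorder_neqE)

lemma open_M0reg: "open (M0reg :: ('n::{finite,linorder}) pt set)"
proof -
  have eq: "M0reg = (\<Inter>i. \<Inter>j. {x :: 'n pt. i < j \<longrightarrow> fst x $ j < fst x $ i})"
    by (auto simp: M0reg_iff)
  have "open {x :: 'n pt. i < j \<longrightarrow> fst x $ j < fst x $ i}" for i j
    by (cases "i < j") (auto intro!: open_Collect_less continuous_intros)
  then show ?thesis unfolding eq by (intro open_INT ballI finite)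
qed

lemma subspace_Vminus: "subspace Vminus"
  by (simp add: subspace_def Vminus_iff adj_add adj_scaleR)

lemma M0reg_ball:
  assumes "(x :: ('n::{finite,linorder}) pt) \<in> M0reg"
  shows "\<exists>e>0. \<forall>v. norm v < e \<longrightarrow> x + v \<in> M0reg"
proof -
  obtain e where "e > 0" "ball x e \<subseteq> M0reg"
    using open_M0reg assms openE by blast
  then show ?thesis
    by (intro exI[of _ e] conjI allI impI) (auto simp del: split_paired_All simp: subset_iff dist_norm)
qed

interpretation minus: projected_open "Vminus :: ('n::{finite,linorder}) pt set" M0minus proj_herm
proof (intro projected_open.intro relatively_open.intro projected_open_axioms.intro)
  show "subspace Vminus" by (rule subspace_Vminus)
  show "\<exists>e>0. \<forall>v\<in>Vminus. norm v < e \<longrightarrow> x + v \<in> M0minus" if "x \<in> M0minus" for x :: "'n pt"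
    using that M0reg_ball[of x] by (auto simp: M0minus_iff Vminus_iff adj_add)
  show "linear (proj_herm :: 'n pt \<Rightarrow> _)"
    by (rule linearI) (auto simp: proj_herm_def mminus_linear)
  show "proj_herm x \<in> Vminus" for x :: "'n pt"
    by (simp add: Vminus_iff proj_herm_def adj_mminus)
  show "proj_herm v = v" if "v \<in> Vminus" for v :: "'n pt"
    using that by (simp add: Vminus_iff proj_herm_def mminus_id)
  show "proj_herm x \<bullet> y = x \<bullet> proj_herm y" for x y :: "'n pt"
    by (simp add: proj_herm_def inner_prod_def inner_mat mminus_def adj_scaleR adj_add ip_linear ip_adj_left)
qed

interpretation full: projected_open "UNIV :: ('n::{finite,linorder}) pt set" M0reg "\<lambda>x. x"
proof (intro projected_open.intro relatively_open.intro projected_open_axioms.intro)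
  show "\<exists>e>0. \<forall>v\<in>UNIV. norm v < e \<longrightarrow> x + v \<in> M0reg" if "x \<in> M0reg" for x :: "'n pt"
    using M0reg_ball[OF that] by simp
qed (auto intro: linear_id[unfolded id_def])

text \<open>Tangential derivatives see only values on the slice, so every extension has the same
  projected gradient there.\<close>

lemma grad_restrict:
  assumes "full.smooth f" "minus.smooth F" "p \<in> M0minus" "\<And>p. p \<in> M0minus \<Longrightarrow> f p = F p"
  shows "minus.grad F p = proj_herm (full.grad f p)"
proof (rule minus.grad_eqI)
  fix v :: "'a pt" assume v: "v \<in> Vminus"
  have "proj_herm (full.grad f p) \<bullet> v = full.grad f p \<bullet> v"
    by (simp add: minus.P_selfadjoint minus.P_id v)
  also have "\<dots> = dirderiv f p v"
    using assms by (intro full.inner_grad) (auto simp: M0minus_iff)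
  also have "\<dots> = dirderiv F p v"
    using assms v by (intro minus.dirderiv_cong) auto
  finally show "proj_herm (full.grad f p) \<bullet> v = dirderiv F p v" .
qed (rule minus.P_in, fact+)

section \<open>The derivatives of the statement as components of gradients\<close>

lemma diag_mat_G0minus: "diag_mat a \<in> G0minus"
  by (auto simp: G0minus_def herm_def adj_diag_mat) (auto simp: diagpart_def diag_mat_def vec_eq_iff)

lemma diagvec_diag_mat: "diagvec (diag_mat a) = a"
  by (simp add: diagvec_def diag_mat_def)

lemma G0minus_diag_mat:
  assumes "X \<in> G0minus"
  shows "X = diag_mat (diagvec X)"
proof -
  have h: "adj X = X" "diagpart X = X" using assms by (auto simp: G0minus_def herm_def)
  have "cnj (X $ i $ i) = X $ i $ i" for i
    using arg_cong[OF h(1), of "\<lambda>X. X $ i $ i"] by (simp add: adj_def)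
  then have "X $ i $ i = complex_of_real (Re (X $ i $ i))" for i
    by (simp add: complex_eq_iff)
  moreover have "i \<noteq> j \<Longrightarrow> X $ i $ j = 0" for i j
    using arg_cong[OF h(2), of "\<lambda>X. X $ i $ j"] by (simp add: diagpart_def)
  ultimately show ?thesis
    by (auto simp: vec_eq_iff diag_mat_def diagvec_def)
qed

lemma nabla1_eqI:
  assumes "\<And>u. a \<bullet> u = dirderiv f p (u, 0)"
  shows "nabla1 f p = diag_mat a"
  unfolding nabla1_def
proof (rule the_equality)
  show "diag_mat a \<in> G0minus \<and> (\<forall>X0\<in>G0minus. ip (diag_mat a) X0 = dirderiv f p (diagvec X0, 0))"
    by (simp add: diag_mat_G0minus ip_diag_mat_inner assms)
  fix D :: "'a mat"
  assume D: "D \<in> G0minus \<and> (\<forall>X0\<in>G0minus. ip D X0 = dirderiv f p (diagvec X0, 0))"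
  then have d: "D = diag_mat (diagvec D)" using G0minus_diag_mat by blast
  have "diagvec D \<bullet> u = a \<bullet> u" for u
  proof -
    have "diagvec D \<bullet> u = ip (diag_mat (diagvec D)) (diag_mat u)"
      by (simp add: ip_diag_mat_inner diagvec_diag_mat)
    also have "\<dots> = dirderiv f p (u, 0)"
      using D d diag_mat_G0minus[of u] by (metis diagvec_diag_mat)
    finally show ?thesis by (simp add: assms)
  qed
  then have "diagvec D = a" by (metis vector_eq_rdot)
  then show "D = diag_mat a" using d by simp
qed

lemma nabla1_minus:
  assumes "minus.smooth F" "p \<in> M0minus"
  shows "nabla1 F p = diag_mat (fst (minus.grad F p))"
proof (rule nabla1_eqI)
  fix u
  have "fst (minus.grad F p) \<bullet> u = minus.grad F p \<bullet> (u, 0)" by (simp add: inner_prod_def)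
  also have "\<dots> = dirderiv F p (u, 0)" using assms by (intro minus.inner_grad) (auto simp: Vminus_iff)
  finally show "fst (minus.grad F p) \<bullet> u = dirderiv F p (u, 0)" .
qed

lemma nabla1_full:
  assumes "full.smooth f" "p \<in> M0reg"
  shows "nabla1 f p = diag_mat (fst (full.grad f p))"
proof (rule nabla1_eqI)
  fix u
  have "fst (full.grad f p) \<bullet> u = full.grad f p \<bullet> (u, 0)" by (simp add: inner_prod_def)
  also have "\<dots> = dirderiv f p (u, 0)" using assms by (intro full.inner_grad) auto
  finally show "fst (full.grad f p) \<bullet> u = dirderiv f p (u, 0)" .
qed

lemma d2m_minus:
  assumes "minus.smooth F" "p \<in> M0minus"
  shows "d2m F p = snd (minus.grad F p)"
  unfolding d2m_def
proof (rule the_equality)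
  let ?A = "snd (minus.grad F p)"
  have A: "adj ?A = ?A" using minus.grad_in[of F p] by (simp add: Vminus_iff)
  have *: "?A \<bullet> X = dirderiv F p (0, X)" if "adj X = X" for X
  proof -
    have "?A \<bullet> X = minus.grad F p \<bullet> (0, X)" by (simp add: inner_prod_def)
    also have "\<dots> = dirderiv F p (0, X)" using assms that by (intro minus.inner_grad) (auto simp: Vminus_iff)
    finally show ?thesis .
  qed
  show "herm ?A \<and> (\<forall>X. herm X \<longrightarrow> ip ?A X = dirderiv F p (0, X))"
    using A * inner_mat[of ?A] by (simp add: herm_def)
  fix D assume D: "herm D \<and> (\<forall>X. herm X \<longrightarrow> ip D X = dirderiv F p (0, X))"
  have h: "adj (D - ?A) = D - ?A" using D A by (simp add: herm_def adj_diff)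
  then have "ip D (D - ?A) = ?A \<bullet> (D - ?A)" using D * by (simp add: herm_def)
  then have "(D - ?A) \<bullet> (D - ?A) = 0"
    using inner_mat[of "D - ?A" "D - ?A"] inner_mat[of ?A "D - ?A"] h A by (simp add: ip_linear)
  then show "D = ?A" by simp
qed

lemma d2_full:
  assumes "full.smooth f" "p \<in> M0reg"
  shows "d2 f p = adj (snd (full.grad f p))"
  unfolding d2_def
proof (rule the_equality)
  let ?A = "snd (full.grad f p)"
  have *: "?A \<bullet> X = dirderiv f p (0, X)" for X
  proof -
    have "?A \<bullet> X = full.grad f p \<bullet> (0, X)" by (simp add: inner_prod_def)
    also have "\<dots> = dirderiv f p (0, X)" using assms by (intro full.inner_grad) auto
    finally show ?thesis .
  qed
  show "\<forall>X. ip (adj ?A) X = dirderiv f p (0, X)" by (simp flip: inner_mat add: *)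
  fix D assume D: "\<forall>X. ip D X = dirderiv f p (0, X)"
  have "adj D \<bullet> X = ?A \<bullet> X" for X using D * by (simp add: inner_mat)
  then have "adj D = ?A" by (metis vector_eq_rdot)
  then show "D = adj ?A" by (metis adj_adj)
qed

lemma mminus_adj: "mminus (adj X) = mminus X"
  by (simp add: mminus_def add.commute)

lemma ip_diag_mat_diagpart: "ip (diag_mat a) (diagpart X) = ip (diag_mat a) X"
  by (simp add: ip_diag_mat diagpart_def)

lemma red_restrict:
  assumes f: "is_ext f F" "minus.smooth F" and h: "is_ext h H" "minus.smooth H" and p: "p \<in> M0minus"
  shows "red1 f h p = biv1 p (minus.grad F p) (minus.grad H p)"
    and "red2 f h p = biv2 p (minus.grad F p) (minus.grad H p)"
proof -
  obtain q J where qJ: "p = (q, J)" by (cases p)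
  have reg: "p \<in> M0reg" and J: "adj J = J" using p by (auto simp: M0minus_iff qJ)
  have sf: "full.smooth f" and sh: "full.smooth h" using f h by (auto simp: is_ext_def Cinv0_def)
  have gF: "minus.grad F p = proj_herm (full.grad f p)"
    using f by (intro grad_restrict sf p) (auto simp: is_ext_def)
  have gH: "minus.grad H p = proj_herm (full.grad h p)"
    using h by (intro grad_restrict sh p) (auto simp: is_ext_def)
  define a A where "a = fst (minus.grad F p)" and "A = snd (minus.grad F p)"
  define b B where "b = fst (minus.grad H p)" and "B = snd (minus.grad H p)"
  have n1: "nabla1 f p = diag_mat a" "nabla1 h p = diag_mat b"
    using nabla1_full[OF sf reg] nabla1_full[OF sh reg] by (simp_all add: a_def b_def gF gH proj_herm_def)
  have m: "mminus (d2 f p) = A" "mminus (d2 h p) = B"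
    using d2_full[OF sf reg] d2_full[OF sh reg] by (simp_all add: A_def B_def gF gH proj_herm_def mminus_adj)
  have AB: "adj A = A" "adj B = B" 
    using minus.grad_in[of F p] minus.grad_in[of H p] by (simp_all add: A_def B_def Vminus_iff)
  have g: "minus.grad F p = (a, A)" "minus.grad H p = (b, B)" by (simp_all add: a_def A_def b_def B_def)
  have zero: "mplus J = 0" by (simp add: mplus_eq_0_iff J)
  show "red1 f h p = biv1 p (minus.grad F p) (minus.grad H p)"
    unfolding g unfolding qJ biv1_herm[OF J AB]
    using red1_restrict[OF J, of q "d2 f p" "d2 h p"] n1 m
    by (simp add: red1_def Let_def ip_diag_mat_diagpart zero ip_linear qJ)
  \<comment> \<open>X J is the adjoint of J X, so their diagonals have equal real parts; the
    resulting 2 absorbs the prefactor 1/2 of \<open>red2\<close>.\<close>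
  have di: "ip (diag_mat c) (J ** X + X ** J) = 2 * ip (diag_mat c) (J ** X)" if "adj X = X" for c X
    using ip_adj[of "diag_mat c" "J ** X"] by (simp add: adj_diag_mat adj_mult J that ip_linear)
  show "red2 f h p = biv2 p (minus.grad F p) (minus.grad H p)"
    unfolding g
    using red2_restrict_Rq[OF J AB, of q] red2_restrict_remainder[OF J, of "d2 f p" "d2 h p"] n1 m
    by (simp add: red2_def biv2_def Let_def nabla2_def nabla2'_def ip_diag_mat_diagpart mminus_anticomm[OF J]
        mplus_comm[OF J] di AB qJ)
qed

subsection \<open>Differentiating the bivectors\<close>

lemma coth_diff_derivative:
  assumes "inj (($) q)"
  shows "((\<lambda>t. coth_diff (q + t *\<^sub>R \<xi>) i j) has_real_derivative (1 - (coth_diff q i j)\<^sup>2) * (\<xi> $ i - \<xi> $ j)) (at 0)"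
proof (cases "i = j")
  case True
  then show ?thesis by (simp add: coth_diff_def)
next
  case False
  let ?u = "q $ i - q $ j" and ?w = "\<xi> $ i - \<xi> $ j"
  have "?u \<noteq> 0" using False assms by (auto dest: injD)
  then have nz: "sinh ?u \<noteq> 0" by simp
  have "((\<lambda>t. cosh (?u + t * ?w) / sinh (?u + t * ?w)) has_real_derivative
      (sinh ?u * ?w * sinh ?u - cosh ?u * (cosh ?u * ?w)) / (sinh ?u * sinh ?u)) (at 0)"
    using nz by (auto intro!: derivative_eq_intros)
  moreover have "(sinh ?u * ?w * sinh ?u - cosh ?u * (cosh ?u * ?w)) / (sinh ?u * sinh ?u)
      = (1 - (cosh ?u / sinh ?u)\<^sup>2) * ?w"
    using nz by (simp add: field_simps power2_eq_square)
  moreover have "coth_diff (q + t *\<^sub>R \<xi>) i j = cosh (?u + t * ?w) / sinh (?u + t * ?w)" for t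
    using False by (simp add: coth_diff_def algebra_simps)
  moreover have "coth_diff q i j = cosh ?u / sinh ?u" using False by (simp add: coth_diff_def)
  ultimately show ?thesis by (simp only:)
qed

text \<open>Since coth' = 1 - coth^2, the algebra generated by this single function is closed under
  differentiation.\<close>

lemma smooth_coth_diff: "minus.smooth (\<lambda>x. coth_diff (fst x) i j)"
proof (rule minus.smooth_function_algebra[where G = "{\<lambda>x. coth_diff (fst x) i j}"])
  let ?g = "\<lambda>x :: 'a pt. coth_diff (fst x) i j"
  fix g :: "'a pt \<Rightarrow> real" assume g: "g \<in> {?g}"
  show "continuous (at x within M0minus) g" if "x \<in> M0minus" for x
  proof (cases "i = j")
    case True
    then show ?thesis using g by (simp add: coth_diff_def)
  next
    case False
    then have "fst x $ i - fst x $ j \<noteq> 0"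
      using that M0reg_inj[of x] by (auto simp: M0minus_iff dest: injD)
    then show ?thesis using g False by (auto simp: coth_diff_def intro!: continuous_intros)
  qed
  fix v :: "'a pt"
  have gen: "?g \<in> function_algebra {?g}"
    by (intro function_algebra.gen) auto
  \<comment> \<open>The difference is spelled out this way because the algebra is generated by sums
    and products only.\<close>
  have "(\<lambda>x. (1 + (-1) * (?g x * ?g x)) * (fst v $ i - fst v $ j)) \<in> function_algebra {?g}"
    by (intro function_algebra.mult function_algebra.add function_algebra.const gen)
  moreover have "((\<lambda>t. g (x + t *\<^sub>R v)) has_real_derivative
      (1 + (-1) * (?g x * ?g x)) * (fst v $ i - fst v $ j)) (at 0)" if "x \<in> M0minus" for x
    using coth_diff_derivative[OF M0reg_inj, of x "fst v" i j] that g
    by (simp add: M0minus_iff power2_eq_square)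
  ultimately show "\<exists>g'\<in>function_algebra {?g}. \<forall>x\<in>M0minus. ((\<lambda>t. g (x + t *\<^sub>R v)) has_real_derivative g' x) (at 0)"
    by (rule_tac bexI) auto
qed (auto intro: function_algebra.gen)

lemma ip_Rq_sum: "ip X (Rq q Y) = (\<Sum>i\<in>UNIV. \<Sum>j\<in>UNIV.
    (Re (X $ i $ j) * Re (Y $ j $ i) - Im (X $ i $ j) * Im (Y $ j $ i)) * coth_diff q j i)"
  unfolding ip_sum Rq_nth by (intro sum.cong refl) (simp add: algebra_simps)

lemma ip_Rq_derivative:
  assumes "inj (($) q)"
  shows "((\<lambda>t. ip (X + t *\<^sub>R X') (Rq (q + t *\<^sub>R \<xi>) (Y + t *\<^sub>R Y'))) has_real_derivative
    ip X' (Rq q Y) + ip X (Rq q Y') + ip X (dRq q \<xi> Y)) (at 0)"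
proof -
  have "((\<lambda>t. ip (X + t *\<^sub>R X') (Rq (q + t *\<^sub>R \<xi>) (Y + t *\<^sub>R Y'))) has_real_derivative
    (\<Sum>i\<in>UNIV. \<Sum>j\<in>UNIV.
      (Re (X' $ i $ j) * Re (Y $ j $ i) - Im (X' $ i $ j) * Im (Y $ j $ i)) * coth_diff q j i
      + (Re (X $ i $ j) * Re (Y' $ j $ i) - Im (X $ i $ j) * Im (Y' $ j $ i)) * coth_diff q j i
      + (1 - (coth_diff q i j)\<^sup>2) * ((\<xi> $ j - \<xi> $ i) * Re (X $ i $ j * Y $ j $ i)))) (at 0)"
    unfolding ip_Rq_sum
  proof (intro DERIV_sum, goal_cases)
    case (1 i j)
    have sq: "(coth_diff q i j)\<^sup>2 = (coth_diff q j i)\<^sup>2" by (subst coth_diff_swap) simp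
    show ?case unfolding sq
      by (rule derivative_eq_intros coth_diff_derivative[OF assms] refl | simp)+ (simp add: algebra_simps)
  qed
  then show ?thesis unfolding ip_dRq ip_Rq_sum by (simp only: sum.distrib)
qed

lemma ip_derivative: "((\<lambda>t. ip X (Y + t *\<^sub>R Z)) has_real_derivative ip X Z) (at 0)"
  by (auto simp: ip_linear intro!: derivative_eq_intros)

lemma biv_derivative:
  assumes "inj (($) (fst x))"
  shows "((\<lambda>t. biv1 (x + t *\<^sub>R v) \<alpha> \<beta>) has_real_derivative dbiv1 x v \<alpha> \<beta>) (at 0)"
    and "((\<lambda>t. biv2 (x + t *\<^sub>R v) \<alpha> \<beta>) has_real_derivative dbiv2 x v \<alpha> \<beta>) (at 0)"
proof -
  let ?A = "snd \<alpha>" and ?B = "snd \<beta>" and ?J = "snd x" and ?V = "snd v"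
  have 1: "((\<lambda>t. ip (?J ** ?A + t *\<^sub>R (?V ** ?A)) (Rq (fst x + t *\<^sub>R fst v) ?B)) has_real_derivative
      ip (?V ** ?A) (Rq (fst x) ?B) + ip (?J ** ?A) (dRq (fst x) (fst v) ?B)) (at 0)"
    using ip_Rq_derivative[OF assms, of "?J ** ?A" "?V ** ?A" "fst v" ?B 0]
    by (simp add: Rq_linear ip_linear Rq_def[of _ 0] zero_vec_def[symmetric] cong: if_cong)
  have 2: "((\<lambda>t. ip ?A (Rq (fst x + t *\<^sub>R fst v) (?J ** ?B + t *\<^sub>R (?V ** ?B)))) has_real_derivative
      ip ?A (Rq (fst x) (?V ** ?B)) + ip ?A (dRq (fst x) (fst v) (?J ** ?B))) (at 0)"
    using ip_Rq_derivative[OF assms, of ?A 0 "fst v" "?J ** ?B" "?V ** ?B"] by (simp add: ip_linear)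
  show "((\<lambda>t. biv1 (x + t *\<^sub>R v) \<alpha> \<beta>) has_real_derivative dbiv1 x v \<alpha> \<beta>) (at 0)"
    unfolding biv1_def fst_add snd_add fst_scaleR snd_scaleR matrix_ring
    by (rule DERIV_cong, rule DERIV_add[OF DERIV_const DERIV_cmult[OF DERIV_add[OF 1 2]]]) (simp add: dbiv1_def)
  show "((\<lambda>t. biv2 (x + t *\<^sub>R v) \<alpha> \<beta>) has_real_derivative dbiv2 x v \<alpha> \<beta>) (at 0)"
    unfolding biv2_def fst_add snd_add fst_scaleR snd_scaleR matrix_ring
    by (rule DERIV_cong, rule DERIV_add[OF DERIV_diff[OF ip_derivative ip_derivative]
          DERIV_cmult[OF ip_Rq_derivative[OF assms]]]) (simp add: dbiv2_def)
qed

lemma smooth_ip_Rq: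
  assumes "\<And>i j. minus.smooth (\<lambda>x. Re (M x $ i $ j))" "\<And>i j. minus.smooth (\<lambda>x. Im (M x $ i $ j))"
    "\<And>i j. minus.smooth (\<lambda>x. Re (N x $ i $ j))" "\<And>i j. minus.smooth (\<lambda>x. Im (N x $ i $ j))"
  shows "minus.smooth (\<lambda>x. ip (M x) (Rq (fst x) (N x)))"
  unfolding ip_Rq_sum
  by (intro minus.smooth_sum minus.smooth_mult minus.smooth_diff smooth_coth_diff assms)

lemma smooth_biv:
  "minus.smooth (\<lambda>x. biv1 x \<alpha> \<beta>)" "minus.smooth (\<lambda>x. biv2 x \<alpha> \<beta>)"
proof -
  have lin: "minus.smooth (\<lambda>x. Re ((snd x ** A) $ i $ j))" "minus.smooth (\<lambda>x. Im ((snd x ** A) $ i $ j))"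
    for A :: "'a mat" and i j
    by (intro minus.smooth_linear linearI; simp add: matrix_ring)+
  have ip: "minus.smooth (\<lambda>x. ip X (snd x ** A))" for X A :: "'a mat"
    by (intro minus.smooth_linear linearI; simp add: matrix_ring ip_linear)+
  show "minus.smooth (\<lambda>x. biv1 x \<alpha> \<beta>)" "minus.smooth (\<lambda>x. biv2 x \<alpha> \<beta>)"
    unfolding biv1_def biv2_def
    by (intro minus.smooth_add minus.smooth_diff minus.smooth_mult minus.smooth_const smooth_ip_Rq lin ip)+
qed

lemma pencil_bivector:
  "bivector Vminus M0minus proj_herm (\<lambda>x \<alpha> \<beta>. s * biv1 x \<alpha> \<beta> + t * biv2 x \<alpha> \<beta>)
    (\<lambda>x v \<alpha> \<beta>. s * dbiv1 x v \<alpha> \<beta> + t * dbiv2 x v \<alpha> \<beta>) (\<lambda>x \<alpha>. s *\<^sub>R ham1 x \<alpha> + t *\<^sub>R ham2 x \<alpha>)"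
proof (intro bivector.intro minus.projected_open_axioms bivector_axioms.intro)
  have bil: "bilinear (\<lambda>\<alpha> \<beta>. s * B \<alpha> \<beta> + t * C \<alpha> \<beta>)" if "bilinear B" "bilinear C" for B C :: "'a pt \<Rightarrow> 'a pt \<Rightarrow> real"
    unfolding bilinear_def
    by (safe; rule linearI; simp add: bilinear_ladd[OF that(1)] bilinear_ladd[OF that(2)] bilinear_radd[OF that(1)]
        bilinear_radd[OF that(2)] bilinear_lmul[OF that(1)] bilinear_lmul[OF that(2)] bilinear_rmul[OF that(1)]
        bilinear_rmul[OF that(2)] algebra_simps)
  fix x v \<alpha> \<beta> :: "'a pt"
  show "bilinear (\<lambda>\<alpha> \<beta>. s * biv1 x \<alpha> \<beta> + t * biv2 x \<alpha> \<beta>)"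
    "bilinear (\<lambda>\<alpha> \<beta>. s * dbiv1 x v \<alpha> \<beta> + t * dbiv2 x v \<alpha> \<beta>)"
    by (intro bil biv_bilinear)+
  show "s * biv1 x \<alpha> \<beta> + t * biv2 x \<alpha> \<beta> = - (s * biv1 x \<beta> \<alpha> + t * biv2 x \<beta> \<alpha>)"
    by (simp add: biv_antisym[of x \<alpha> \<beta>])
  show "minus.smooth (\<lambda>x. s * biv1 x \<alpha> \<beta> + t * biv2 x \<alpha> \<beta>)"
    by (intro minus.smooth_add minus.smooth_mult minus.smooth_const smooth_biv)
  assume x: "x \<in> M0minus"
  then have inj: "inj (($) (fst x))" by (simp add: M0minus_iff M0reg_inj)
  show "((\<lambda>r. s * biv1 (x + r *\<^sub>R v) \<alpha> \<beta> + t * biv2 (x + r *\<^sub>R v) \<alpha> \<beta>) has_real_derivative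
      s * dbiv1 x v \<alpha> \<beta> + t * dbiv2 x v \<alpha> \<beta>) (at 0)"
    by (intro DERIV_add DERIV_cmult biv_derivative inj)
  show "s *\<^sub>R ham1 x \<alpha> + t *\<^sub>R ham2 x \<alpha> \<in> Vminus"
    by (simp add: Vminus_iff ham1_def ham2_def adj_add adj_scaleR adj_mminus)
  show "(s *\<^sub>R ham1 x \<alpha> + t *\<^sub>R ham2 x \<alpha>) \<bullet> \<beta> = s * biv1 x \<alpha> \<beta> + t * biv2 x \<alpha> \<beta>" if "\<beta> \<in> Vminus"
    using that by (simp add: Vminus_iff inner_add_left inner_ham)
qed

subsection \<open>The torus action\<close>

definition torus_conj :: "'n::finite mat \<Rightarrow> 'n mat \<Rightarrow> 'n mat" where
  "torus_conj \<tau> X = \<tau> ** X ** adj \<tau>"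

lemma torus_mult:
  assumes "\<tau> \<in> torus"
  shows "\<tau> ** adj \<tau> = mat 1" "adj \<tau> ** \<tau> = mat 1"
  using assms by (auto simp: torus_def matrix_left_right_inverse)

lemma adj_torus:
  assumes "\<tau> \<in> torus"
  shows "adj \<tau> \<in> torus"
proof -
  have d: "diagpart \<tau> = \<tau>" using assms by (simp add: torus_def)
  have "\<tau> $ i $ j = 0" if "i \<noteq> j" for i j
    using arg_cong[OF d, of "\<lambda>X. X $ i $ j"] that by (simp add: diagpart_def)
  then have "diagpart (adj \<tau>) = adj \<tau>" by (auto simp: diagpart_def adj_def vec_eq_iff)
  then show ?thesis using torus_mult[OF assms] by (simp add: torus_def)
qed

lemma matrix_inv_torus:
  assumes "\<tau> \<in> torus"
  shows "matrix_inv \<tau> = adj \<tau>"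
proof -
  have "\<exists>A. \<tau> ** A = mat 1 \<and> A ** \<tau> = mat 1" using torus_mult[OF assms] by blast
  then have "matrix_inv \<tau> ** \<tau> = mat 1"
    unfolding matrix_inv_def by (rule someI2_ex) (rule conjunct2)
  then have "matrix_inv \<tau> ** \<tau> ** adj \<tau> = adj \<tau>" by simp
  then show ?thesis using torus_mult[OF assms] by (simp flip: matrix_mul_assoc)
qed

lemma tact_torus: "\<tau> \<in> torus \<Longrightarrow> tact \<tau> p = (fst p, torus_conj \<tau> (snd p))"
  by (simp add: tact_def matrix_inv_torus torus_conj_def)

lemma torus_conj_nth:
  assumes "\<tau> \<in> torus"
  shows "torus_conj \<tau> X $ i $ j = \<tau> $ i $ i * X $ i $ j * cnj (\<tau> $ j $ j)"
proof -
  have d: "diagpart \<tau> = \<tau>" using assms by (simp add: torus_def)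
  have z: "\<tau> $ i $ j = (if i = j then \<tau> $ i $ i else 0)" for i j
    using arg_cong[OF d, of "\<lambda>X. X $ i $ j"] by (auto simp: diagpart_def)
  have 1: "(\<tau> ** X) $ i $ j = \<tau> $ i $ i * X $ i $ j" for X i j
  proof -
    have "(\<tau> ** X) $ i $ j = (\<Sum>k\<in>UNIV. if i = k then \<tau> $ i $ i * X $ k $ j else 0)"
      unfolding matrix_matrix_mult_def vec_lambda_beta by (intro sum.cong refl) (subst z, simp)
    then show ?thesis by simp
  qed
  have "torus_conj \<tau> X = adj (\<tau> ** adj (\<tau> ** X))"
    by (simp add: torus_conj_def adj_mult)
  also have "\<dots> $ i $ j = cnj ((\<tau> ** adj (\<tau> ** X)) $ j $ i)" by (simp add: adj_def)
  also have "\<dots> = \<tau> $ i $ i * X $ i $ j * cnj (\<tau> $ j $ j)"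
    unfolding 1 by (simp add: adj_def 1)
  finally show ?thesis .
qed

lemma torus_unit:
  assumes "\<tau> \<in> torus"
  shows "\<tau> $ i $ i * cnj (\<tau> $ i $ i) = 1"
proof -
  have "torus_conj \<tau> (mat 1) = mat 1" using torus_mult[OF assms] by (simp add: torus_conj_def)
  then show ?thesis using torus_conj_nth[OF assms, of "mat 1" i i] by (simp add: mat_def)
qed

lemma adj_torus_conj: "adj (torus_conj \<tau> X) = torus_conj \<tau> (adj X)"
  by (simp add: torus_conj_def adj_mult matrix_mul_assoc)

lemma torus_conj_linear:
  "torus_conj \<tau> (X + Y) = torus_conj \<tau> X + torus_conj \<tau> Y" "torus_conj \<tau> (c *\<^sub>R X) = c *\<^sub>R torus_conj \<tau> X"
  by (simp_all add: torus_conj_def matrix_ring)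

lemma torus_conj_mult:
  assumes "\<tau> \<in> torus"
  shows "torus_conj \<tau> X ** torus_conj \<tau> Y = torus_conj \<tau> (X ** Y)"
proof -
  have "torus_conj \<tau> X ** torus_conj \<tau> Y = \<tau> ** X ** (adj \<tau> ** \<tau>) ** Y ** adj \<tau>"
    by (simp only: torus_conj_def matrix_mul_assoc)
  then show ?thesis by (simp add: torus_mult[OF assms] torus_conj_def matrix_mul_assoc)
qed

lemma torus_conj_adj:
  assumes "\<tau> \<in> torus"
  shows "torus_conj \<tau> (torus_conj (adj \<tau>) X) = X"
proof -
  have "torus_conj \<tau> (torus_conj (adj \<tau>) X) = (\<tau> ** adj \<tau>) ** X ** (\<tau> ** adj \<tau>)"
    by (simp only: torus_conj_def matrix_mul_assoc adj_adj)
  then show ?thesis by (simp add: torus_mult[OF assms])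
qed

lemma ip_torus_conj:
  assumes "\<tau> \<in> torus"
  shows "ip (torus_conj \<tau> X) (torus_conj \<tau> Y) = ip X Y"
proof -
  have "torus_conj \<tau> Z $ i $ i = Z $ i $ i" for Z i
    using torus_unit[OF assms, of i] by (simp add: torus_conj_nth[OF assms] mult.assoc mult.left_commute)
  then show ?thesis by (simp add: ip_def torus_conj_mult[OF assms] mtrace_def)
qed

lemma ip_diag_mat_torus_conj:
  assumes "\<tau> \<in> torus"
  shows "ip (diag_mat a) (torus_conj \<tau> X) = ip (diag_mat a) X"
proof -
  have "torus_conj \<tau> X $ i $ i = X $ i $ i" for i
    using torus_unit[OF assms, of i] by (simp add: torus_conj_nth[OF assms] mult.assoc mult.left_commute)
  then show ?thesis by (simp add: ip_diag_mat)
qed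

lemma Rq_torus_conj:
  assumes "\<tau> \<in> torus"
  shows "Rq q (torus_conj \<tau> X) = torus_conj \<tau> (Rq q X)"
  by (simp add: vec_eq_iff Rq_nth torus_conj_nth[OF assms])

lemma biv_tact:
  assumes "\<tau> \<in> torus"
  shows "biv1 (tact \<tau> x) (tact \<tau> \<alpha>) (tact \<tau> \<beta>) = biv1 x \<alpha> \<beta>"
    "biv2 (tact \<tau> x) (tact \<tau> \<alpha>) (tact \<tau> \<beta>) = biv2 x \<alpha> \<beta>"
  by (simp_all add: biv1_def biv2_def tact_torus[OF assms] torus_conj_mult[OF assms] Rq_torus_conj[OF assms]
      ip_torus_conj[OF assms] ip_diag_mat_torus_conj[OF assms])

lemma linear_tact:
  assumes "\<tau> \<in> torus"
  shows "linear (tact \<tau>)"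
  by (rule linearI) (simp_all add: tact_torus[OF assms] torus_conj_linear)

lemma tact_M0reg: "p \<in> M0reg \<Longrightarrow> tact \<tau> p \<in> M0reg"
  by (simp add: M0reg_iff tact_def)

lemma tact_M0minus: "\<tau> \<in> torus \<Longrightarrow> p \<in> M0minus \<Longrightarrow> tact \<tau> p \<in> M0minus"
  by (simp add: M0minus_iff tact_M0reg) (simp add: tact_torus adj_torus_conj)

lemma tact_Vminus: "\<tau> \<in> torus \<Longrightarrow> p \<in> Vminus \<Longrightarrow> tact \<tau> p \<in> Vminus"
  by (simp add: Vminus_iff tact_torus adj_torus_conj)

lemma tact_proj_herm:
  assumes "\<tau> \<in> torus"
  shows "tact \<tau> (proj_herm p) = proj_herm (tact \<tau> p)"
  by (simp add: tact_torus[OF assms] proj_herm_def mminus_def torus_conj_linear adj_torus_conj)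

lemma inner_tact:
  assumes "\<tau> \<in> torus"
  shows "tact \<tau> u \<bullet> v = u \<bullet> tact (adj \<tau>) v"
proof -
  have "ip (torus_conj \<tau> (adj U)) W = ip (adj U) (torus_conj (adj \<tau>) W)" for U W
    using ip_torus_conj[OF assms, of "adj U" "torus_conj (adj \<tau>) W"] by (simp add: torus_conj_adj[OF assms])
  then show ?thesis
    by (simp add: tact_torus[OF assms] tact_torus[OF adj_torus[OF assms]] inner_prod_def inner_mat adj_torus_conj)
qed

lemma tact_tact_adj:
  assumes "\<tau> \<in> torus"
  shows "tact \<tau> (tact (adj \<tau>) v) = v"
  by (simp add: tact_torus[OF assms] tact_torus[OF adj_torus[OF assms]] torus_conj_adj[OF assms])

text \<open>The torus acts by linear isometries preserving the slice, so gradients of invariant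
  functions are equivariant; with \<open>biv_tact\<close> this makes the brackets invariant.\<close>

lemma grad_tact:
  assumes F: "F \<in> Cinvm" and \<tau>: "\<tau> \<in> torus" and p: "p \<in> M0minus"
  shows "minus.grad F (tact \<tau> p) = tact \<tau> (minus.grad F p)"
proof (rule minus.grad_eqI)
  show s: "minus.smooth F" using F by (simp add: Cinvm_def)
  show "tact \<tau> p \<in> M0minus" by (rule tact_M0minus[OF \<tau> p])
  show "tact \<tau> (minus.grad F p) \<in> Vminus" by (rule tact_Vminus[OF \<tau> minus.grad_in])
  fix v :: "'a pt" assume v: "v \<in> Vminus"
  let ?v = "tact (adj \<tau>) v"
  have v': "?v \<in> Vminus" by (rule tact_Vminus[OF adj_torus[OF \<tau>] v])
  have "tact \<tau> (minus.grad F p) \<bullet> v = dirderiv F p ?v"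
    by (simp add: inner_tact[OF \<tau>] minus.inner_grad[OF s p v'])
  also have "\<dots> = dirderiv (\<lambda>x. F (tact \<tau> x)) p ?v"
    using F \<tau> by (intro minus.dirderiv_cong p v') (auto simp: Cinvm_def invariant_on_def)
  also have "\<dots> = dirderiv F (tact \<tau> p) (tact \<tau> ?v)"
    by (simp add: dirderiv_def linear_add[OF linear_tact[OF \<tau>]] linear_scale[OF linear_tact[OF \<tau>]])
  finally show "tact \<tau> (minus.grad F p) \<bullet> v = dirderiv F (tact \<tau> p) v"
    by (simp add: tact_tact_adj[OF \<tau>])
qed

lemma cis_quotient: "((\<lambda>t. (1/t) *\<^sub>R (cis t - 1)) \<longlongrightarrow> \<i>) (at 0)"
proof -
  have "(cos has_real_derivative - sin 0) (at 0)" "(sin has_real_derivative cos 0) (at (0::real))"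
    by (rule DERIV_cos DERIV_sin)+
  then have "((\<lambda>t. (cos t - 1) / t) \<longlongrightarrow> 0) (at (0::real))" "((\<lambda>t. sin t / t) \<longlongrightarrow> 1) (at (0::real))"
    by (simp_all add: DERIV_def)
  then have "((\<lambda>t. Complex ((cos t - 1) / t) (sin t / t)) \<longlongrightarrow> Complex 0 1) (at 0)"
    by (rule tendsto_Complex)
  moreover have "(\<lambda>t. Complex ((cos t - 1) / t) (sin t / t)) = (\<lambda>t. (1/t) *\<^sub>R (cis t - 1))"
    by (auto simp: complex_eq_iff)
  ultimately show ?thesis by (simp add: complex_eq_iff Complex_eq)
qed

lemma cnj_cis_quotient: "((\<lambda>t. (1/t) *\<^sub>R (cnj (cis t) - 1)) \<longlongrightarrow> - \<i>) (at 0)"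
  using tendsto_cnj[OF cis_quotient] by simp

text \<open>F is constant along the orbit of J under rotation of the k-th coordinate. Orthogonality
  of the gradient to the orbit at its starting point is the claim, up to a factor -2.\<close>

lemma grad_torus_invariant:
  assumes F: "F \<in> Cinvm" and p: "p \<in> M0minus"
  shows "Im ((snd p ** snd (minus.grad F p)) $ k $ k) = 0"
proof -
  define u where "u t i = (if i = k then cis t else 1)" for t and i :: 'a
  define \<tau> :: "real \<Rightarrow> 'a mat" where "\<tau> t = (\<chi> i j. if i = j then u t i else 0)" for t
  let ?J = "snd p" and ?A = "snd (minus.grad F p)"
  have s: "minus.smooth F" using F by (simp add: Cinvm_def)
  have unit: "u t i * cnj (u t i) = 1" for t i
    by (simp add: u_def cis_cnj cis_mult)
  have \<tau>: "\<tau> t \<in> torus" for t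
  proof -
    have "diagpart (\<tau> t) = \<tau> t" by (simp add: diagpart_def \<tau>_def vec_eq_iff)
    moreover have "(\<tau> t ** adj (\<tau> t)) $ i $ j = (mat 1 :: 'a mat) $ i $ j" for i j
    proof -
      have "(\<tau> t ** adj (\<tau> t)) $ i $ j = (\<Sum>l\<in>UNIV. if i = l then if i = j then u t i * cnj (u t i) else 0 else 0)"
        unfolding matrix_matrix_mult_def vec_lambda_beta
        by (intro sum.cong refl) (auto simp: \<tau>_def adj_def)
      then show ?thesis by (simp add: unit mat_def)
    qed
    ultimately show ?thesis by (simp add: torus_def vec_eq_iff)
  qed
  define w where "w t = tact (\<tau> t) p - p" for t
  \<comment> \<open>The commutator [i E_kk, J], the velocity of the orbit at t = 0.\<close>
  define W :: "'a mat" where "W = (\<chi> i j. (if i = k then \<i> * ?J $ i $ j else 0) - (if j = k then \<i> * ?J $ i $ j else 0))"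
  have pV: "p \<in> Vminus" using p by (simp add: M0minus_iff Vminus_iff)
  have wV: "w t \<in> Vminus" for t
    unfolding w_def using subspace_Vminus tact_Vminus[OF \<tau> pV] pV by (intro subspace_diff)
  have w_eq: "w t = (0, torus_conj (\<tau> t) ?J - ?J)" for t
    by (simp add: w_def tact_torus[OF \<tau>] prod_eq_iff)
  have "((\<lambda>t. (1/t) *\<^sub>R (torus_conj (\<tau> t) ?J - ?J)) \<longlongrightarrow> W) (at 0)"
  proof (intro vec_tendstoI)
    fix i j
    have nth: "((1/t) *\<^sub>R (torus_conj (\<tau> t) ?J - ?J)) $ i $ j = ((1/t) *\<^sub>R (u t i * cnj (u t j) - 1)) * ?J $ i $ j" for t
      by (simp add: torus_conj_nth[OF \<tau>]) (simp add: \<tau>_def scaleR_conv_of_real algebra_simps)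
    have lim: "((\<lambda>t. (1/t) *\<^sub>R (u t i * cnj (u t j) - 1)) \<longlongrightarrow> (if i = k then \<i> else 0) - (if j = k then \<i> else 0)) (at 0)"
    proof (cases "i = j")
      case True
      then show ?thesis by (simp add: unit)
    next
      case False
      then show ?thesis using cis_quotient cnj_cis_quotient by (auto simp: u_def)
    qed
    have W: "W $ i $ j = ((if i = k then \<i> else 0) - (if j = k then \<i> else 0)) * ?J $ i $ j"
      by (simp add: W_def)
    have "((\<lambda>t. ((1/t) *\<^sub>R (u t i * cnj (u t j) - 1)) * ?J $ i $ j) \<longlongrightarrow>
        ((if i = k then \<i> else 0) - (if j = k then \<i> else 0)) * ?J $ i $ j) (at 0)"
      by (intro tendsto_intros lim)
    then show "((\<lambda>t. ((1/t) *\<^sub>R (torus_conj (\<tau> t) ?J - ?J)) $ i $ j) \<longlongrightarrow> W $ i $ j) (at 0)"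
      unfolding nth W .
  qed
  then have "((\<lambda>t. (1/t) *\<^sub>R w t) \<longlongrightarrow> (0, W)) (at 0)"
    unfolding w_eq by (auto intro!: tendsto_Pair)
  from minus.curve_quotient_tendsto[OF s p wV this]
  have "((\<lambda>t. (F (p + w t) - F p) / t) \<longlongrightarrow> minus.grad F p \<bullet> (0, W)) (at 0)" .
  moreover have "F (p + w t) = F p" for t
    using F p \<tau> by (simp add: w_def Cinvm_def invariant_on_def)
  ultimately have "((\<lambda>t. 0) \<longlongrightarrow> minus.grad F p \<bullet> (0, W)) (at (0::real))" by simp
  then have "minus.grad F p \<bullet> (0, W) = 0" by (simp add: tendsto_const_iff)
  moreover have A: "adj ?A = ?A" using minus.grad_in[of F p] by (simp add: Vminus_iff)
  ultimately have zero: "ip ?A W = 0" by (simp add: inner_prod_def inner_mat)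
  have "ip ?A W = (\<Sum>i\<in>UNIV. \<Sum>j\<in>UNIV. (if j = k then Re (\<i> * (?A $ i $ j * ?J $ j $ i)) else 0)
      - (if i = k then Re (\<i> * (?A $ i $ j * ?J $ j $ i)) else 0))"
    unfolding ip_sum by (intro sum.cong refl) (auto simp: W_def algebra_simps)
  also have "\<dots> = (\<Sum>i\<in>UNIV. Re (\<i> * (?A $ i $ k * ?J $ k $ i))) - (\<Sum>j\<in>UNIV. Re (\<i> * (?A $ k $ j * ?J $ j $ k)))"
  proof -
    have "(\<Sum>i\<in>UNIV. \<Sum>j\<in>UNIV. if i = k then Re (\<i> * (?A $ i $ j * ?J $ j $ i)) else 0)
        = (\<Sum>j\<in>UNIV. Re (\<i> * (?A $ k $ j * ?J $ j $ k)))"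
      by (subst sum.swap) simp
    then show ?thesis unfolding sum_subtractf by simp
  qed
  also have "\<dots> = Re (\<i> * (?J ** ?A) $ k $ k) - Re (\<i> * (?A ** ?J) $ k $ k)"
    by (simp add: matrix_matrix_mult_def sum_distrib_left mult_ac)
  \<comment> \<open>The two diagonal entries are thus complex conjugates, and the difference equals
    -2 Im (J A)_kk.\<close>
  also have "(?A ** ?J) = adj (?J ** ?A)" using A p by (simp add: adj_mult M0minus_iff)
  finally show ?thesis using zero by (simp add: adj_def)
qed

subsection \<open>The reduced brackets\<close>

lemma Cinvm_smooth: "F \<in> Cinvm \<Longrightarrow> minus.smooth F"
  by (simp add: Cinvm_def)

lemma extension_exists:
  assumes "F \<in> Cinvm"
  shows "is_ext (\<lambda>x. F (proj_herm x)) F"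
proof -
  have in_minus: "proj_herm x \<in> M0minus" if "x \<in> M0reg" for x :: "'a pt"
    using that by (simp add: M0minus_iff M0reg_iff proj_herm_def adj_mminus)
  have "full.smooth (\<lambda>x. F (proj_herm x))"
    using in_minus minus.P_in Cinvm_smooth[OF assms]
    by (intro smooth_along_compose_linear[OF minus.linear_P]) auto
  moreover have "F (proj_herm (tact \<tau> p)) = F (proj_herm p)" if "\<tau> \<in> torus" "p \<in> M0reg" for \<tau> p
    using assms that in_minus by (simp add: Cinvm_def invariant_on_def flip: tact_proj_herm)
  moreover have "proj_herm p = p" if "p \<in> M0minus" for p :: "'a pt"
    using that by (intro minus.P_id) (simp add: M0minus_iff Vminus_iff)
  ultimately show ?thesis
    by (simp add: is_ext_def Cinv0_def invariant_on_def)
qed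

lemma red_minus_eq:
  assumes "F \<in> Cinvm" "H \<in> Cinvm" "p \<in> M0minus"
  shows "red1m F H p = biv1 p (minus.grad F p) (minus.grad H p)"
    and "red2m F H p = biv2 p (minus.grad F p) (minus.grad H p)"
proof -
  have "is_ext (SOME f. is_ext f F) F" "is_ext (SOME h. is_ext h H) H"
    using extension_exists assms by (metis someI)+
  then show "red1m F H p = biv1 p (minus.grad F p) (minus.grad H p)"
    "red2m F H p = biv2 p (minus.grad F p) (minus.grad H p)"
    unfolding red1m_def red2m_def using assms by (auto intro!: red_restrict Cinvm_smooth)
qed

lemma Cinvm_lincomb: "F \<in> Cinvm \<Longrightarrow> G \<in> Cinvm \<Longrightarrow> (\<lambda>y. a * F y + b * G y) \<in> Cinvm"
  by (auto simp: Cinvm_def invariant_on_def intro!: minus.smooth_add minus.smooth_mult minus.smooth_const)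

lemma Cinvm_mult: "F \<in> Cinvm \<Longrightarrow> G \<in> Cinvm \<Longrightarrow> (\<lambda>y. F y * G y) \<in> Cinvm"
  by (auto simp: Cinvm_def invariant_on_def intro!: minus.smooth_mult)

lemma compatible_poisson_red:
  "compatible_poisson (Cinvm :: (('n::{finite,linorder}) pt \<Rightarrow> real) set) M0minus red1m red2m"
  unfolding compatible_poisson_def
proof (intro allI)
  fix s t :: real
  interpret bivector "Vminus :: 'n pt set" M0minus proj_herm "\<lambda>x \<alpha> \<beta>. s * biv1 x \<alpha> \<beta> + t * biv2 x \<alpha> \<beta>"
    "\<lambda>x v \<alpha> \<beta>. s * dbiv1 x v \<alpha> \<beta> + t * dbiv2 x v \<alpha> \<beta>" "\<lambda>x \<alpha>. s *\<^sub>R ham1 x \<alpha> + t *\<^sub>R ham2 x \<alpha>"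
    by (rule pencil_bivector)
  let ?B = "\<lambda>(F :: 'n pt \<Rightarrow> real) H x. s * red1m F H x + t * red2m F H x"
  have B: "?B F H x = bracket F H x" if "F \<in> Cinvm" "H \<in> Cinvm" "x \<in> M0minus" for F H :: "'n pt \<Rightarrow> real" and x
    using that by (simp add: red_minus_eq bracket_def)
  have closed: "?B F H \<in> Cinvm" if F: "F \<in> Cinvm" and H: "H \<in> Cinvm" for F H :: "'n pt \<Rightarrow> real"
  proof -
    \<comment> \<open>Off the slice the reduced brackets depend on the chosen extensions, so
      smoothness is transferred from the bivector formula on the slice.\<close>
    have "minus.smooth (?B F H)"
      by (rule minus.smooth_cong[OF _ smooth_bracket[OF Cinvm_smooth[OF F] Cinvm_smooth[OF H]]]) (simp only: B[OF F H])
    moreover have "?B F H (tact \<tau> p) = ?B F H p" if "\<tau> \<in> torus" "p \<in> M0minus" for \<tau> p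
      using that by (simp add: B[OF F H] tact_M0minus bracket_def grad_tact[OF F] grad_tact[OF H] biv_tact)
    ultimately show ?thesis by (simp add: Cinvm_def invariant_on_def)
  qed
  \<comment> \<open>The inner bracket is identified with the bivector bracket only on the slice;
    tangential gradients need no more.\<close>
  have BB: "?B F (?B G H) x = bracket F (bracket G H) x"
    if "F \<in> Cinvm" "G \<in> Cinvm" "H \<in> Cinvm" "x \<in> M0minus" for F G H x
    unfolding B[OF that(1) closed[OF that(2,3)] that(4)]
    using minus.grad_cong[OF that(4), of "?B G H" "bracket G H"] B[OF that(2,3)] by (simp add: bracket_def)
  have jacobi: "bracket F (bracket G H) x + bracket G (bracket H F) x + bracket H (bracket F G) x = 0"
    if FGH: "F \<in> Cinvm" "G \<in> Cinvm" "H \<in> Cinvm" and x: "x \<in> M0minus" for F G H x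
  proof (rule bracket_jacobi)
    have herm: "adj (snd (minus.grad K x)) = snd (minus.grad K x)" for K
      using minus.grad_in[of K x] by (simp add: Vminus_iff)
    have "inj (($) (fst x))" "adj (snd x) = snd x"
      using x M0reg_inj[of x] by (simp_all add: M0minus_iff)
    then show "s * dbiv1 x (s *\<^sub>R ham1 x (minus.grad F x) + t *\<^sub>R ham2 x (minus.grad F x)) (minus.grad G x) (minus.grad H x)
      + t * dbiv2 x (s *\<^sub>R ham1 x (minus.grad F x) + t *\<^sub>R ham2 x (minus.grad F x)) (minus.grad G x) (minus.grad H x)
      + (s * dbiv1 x (s *\<^sub>R ham1 x (minus.grad G x) + t *\<^sub>R ham2 x (minus.grad G x)) (minus.grad H x) (minus.grad F x)
      + t * dbiv2 x (s *\<^sub>R ham1 x (minus.grad G x) + t *\<^sub>R ham2 x (minus.grad G x)) (minus.grad H x) (minus.grad F x))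
      + (s * dbiv1 x (s *\<^sub>R ham1 x (minus.grad H x) + t *\<^sub>R ham2 x (minus.grad H x)) (minus.grad F x) (minus.grad G x)
      + t * dbiv2 x (s *\<^sub>R ham1 x (minus.grad H x) + t *\<^sub>R ham2 x (minus.grad H x)) (minus.grad F x) (minus.grad G x)) = 0"
      by (intro schouten_pencil herm grad_torus_invariant FGH x)
  qed (use FGH x Cinvm_smooth in auto)
  show "poisson_on (Cinvm :: ('n pt \<Rightarrow> real) set) M0minus ?B"
    unfolding poisson_on_def
  proof (intro conjI ballI allI, goal_cases)
    case (1 F H)
    then show ?case by (rule closed)
  next
    case (2 F G H a b x)
    then show ?case
      unfolding B[OF 2(1,3,4)] B[OF 2(2,3,4)] B[OF Cinvm_lincomb[OF 2(1,2)] 2(3,4)]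
      by (intro bracket_lincomb Cinvm_smooth)
  next
    case (3 F H x)
    then show ?case
      unfolding B[OF 3] B[OF 3(2,1,3)] by (intro bracket_antisym)
  next
    case (4 F G H x)
    then show ?case
      unfolding B[OF 4(1,2,4)] B[OF 4(1,3,4)] B[OF 4(1) Cinvm_mult[OF 4(2,3)] 4(4)]
      by (intro bracket_leibniz Cinvm_smooth)
  next
    case (5 F G H x)
    then show ?case
      unfolding BB[OF 5] BB[OF 5(2,3,1,4)] BB[OF 5(3,1,2,4)] by (rule jacobi)
  qed
qed

theorem theorem4p3:
  fixes F H :: "('n::{finite,linorder}) pt \<Rightarrow> real"
  assumes "F \<in> Cinvm" and "H \<in> Cinvm"
  shows "(\<exists>f. is_ext f F) \<and> (\<exists>h. is_ext h H)
    \<and> (\<forall>f h. is_ext f F \<longrightarrow> is_ext h H \<longrightarrow>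
          (\<forall>p\<in>M0minus. red1 f h p = red1m F H p \<and> red2 f h p = red2m F H p))
    \<and> compatible_poisson (Cinvm :: ('n pt \<Rightarrow> real) set) M0minus red1m red2m
    \<and> (\<forall>q J. (q, J) \<in> M0minus \<longrightarrow>
          red1m F H (q, J) =
            ip (nabla1 F (q, J)) (d2m H (q, J)) - ip (nabla1 H (q, J)) (d2m F (q, J))
          + ip J (comm (Rq q (d2m F (q, J))) (d2m H (q, J))
                  + comm (d2m F (q, J)) (Rq q (d2m H (q, J)))))
    \<and> (\<forall>q J. (q, J) \<in> M0minus \<longrightarrow>
          red2m F H (q, J) =
            ip (nabla1 F (q, J)) (nabla2m H (q, J)) - ip (nabla1 H (q, J)) (nabla2m F (q, J))
          + 2 * ip (nabla2m F (q, J)) (Rq q (nabla2m H (q, J))))"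
proof (intro conjI allI impI ballI)
  show "\<exists>f. is_ext f F" "\<exists>h. is_ext h H" using extension_exists assms by blast+
  show "compatible_poisson (Cinvm :: ('n pt \<Rightarrow> real) set) M0minus red1m red2m"
    by (rule compatible_poisson_red)
next
  fix f h and p :: "'n pt" assume fh: "is_ext f F" "is_ext h H" and p: "p \<in> M0minus"
  show "red1 f h p = red1m F H p" "red2 f h p = red2m F H p"
    using red_restrict[OF fh(1) Cinvm_smooth[OF assms(1)] fh(2) Cinvm_smooth[OF assms(2)] p]
      red_minus_eq[OF assms p] by simp_all
next
  fix q J assume p: "(q, J) \<in> (M0minus :: 'n pt set)"
  have n: "nabla1 F (q, J) = diag_mat (fst (minus.grad F (q, J)))" "d2m F (q, J) = snd (minus.grad F (q, J))"
    "nabla1 H (q, J) = diag_mat (fst (minus.grad H (q, J)))" "d2m H (q, J) = snd (minus.grad H (q, J))"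
    using assms Cinvm_smooth nabla1_minus[OF _ p] d2m_minus[OF _ p] by auto
  have herm: "adj J = J" "adj (d2m F (q, J)) = d2m F (q, J)" "adj (d2m H (q, J)) = d2m H (q, J)"
    using p minus.grad_in[of F "(q, J)"] minus.grad_in[of H "(q, J)"] by (auto simp: M0minus_iff Vminus_iff n)
  show "red1m F H (q, J) = ip (nabla1 F (q, J)) (d2m H (q, J)) - ip (nabla1 H (q, J)) (d2m F (q, J))
      + ip J (comm (Rq q (d2m F (q, J))) (d2m H (q, J)) + comm (d2m F (q, J)) (Rq q (d2m H (q, J))))"
    using biv1_herm[OF herm, of q "fst (minus.grad F (q, J))" "fst (minus.grad H (q, J))"]
      red_minus_eq(1)[OF assms p] by (simp add: n)
  show "red2m F H (q, J) = ip (nabla1 F (q, J)) (nabla2m H (q, J)) - ip (nabla1 H (q, J)) (nabla2m F (q, J))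
      + 2 * ip (nabla2m F (q, J)) (Rq q (nabla2m H (q, J)))"
    using red_minus_eq(2)[OF assms p] by (simp add: biv2_def nabla2m_def n)
qed

end
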